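(* Let $G$ be a finite abelian group and let $\Gamma\subset\operatorname{Aut}(G)$ be a subset with $\{\mathrm{id}_G,-\mathrm{id}_G\}\subset\Gamma$. Then the following statements are equivalent: (a) $\mathcal B_\Gamma(G)$ is root closed. (b) $\mathcal B_\Gamma(G)$ is Krull. (c) $\mathcal B_\Gamma(G)$ is transfer Krull. (d) $\mathcal B_\Gamma(G)$ is weakly Krull. (e) $G$ is an elementary $2$-group and $\Gamma=\{\mathrm{id}_G,-\mathrm{id}_G\}$.
   Context: $G$ is written additively, and an elementary $2$-group is a group with $2g=0$ for all $g$ (the trivial group is included). $\mathcal F(G)$ is the (multiplicative) free abelian monoid with basis $G$, and $\mathcal B_\Gamma(G)=\{g_1\cdot\ldots\cdot g_\ell\in\mathcal F(G):\ \ell\ge0,\ \sum_{i=1}^\ell\gamma_i(g_i)=0\text{ for some }\gamma_1,\dots,\gamma_\ell\in\Gamma\}$, a submonoid of $\mathcal F(G)$. A monoid is a commutative cancellative semigroup with identity; $H^\times$ is its group of units and $\mathsf q(H)$ its quotient group. $H$ is root closed if every $x\in\mathsf q(H)$ with $x^n\in H$ for some $n\in\mathbb N$ lies in $H$. An $s$-ideal of $H$ is a subset $I\subset H$ with $IH\subset I$ (so $\emptyset$ is an $s$-ideal); a prime $s$-ideal is an $s$-ideal $\mathfrak p\subsetneq H$ such that $H\setminus\mathfrak p$ is multiplicatively closed. $\mathfrak X(H)$ is the set of minimal nonempty prime $s$-ideals, and $H_{\mathfrak p}=\{s^{-1}a:a\in H,\ s\in H\setminus\mathfrak p\}\subset\mathsf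 q(H)$. $H$ is weakly Krull if $H=\bigcap_{\mathfrak p\in\mathfrak X(H)}H_{\mathfrak p}$ and $\{\mathfrak p\in\mathfrak X(H):a\in\mathfrak p\}$ is finite for all $a\in H$. $H$ is a Krull monoid if it is weakly Krull and $H_{\mathfrak p}$ is a discrete valuation monoid for all $\mathfrak p\in\mathfrak X(H)$; equivalently, if there is a homomorphism $\varphi\colon H\to D$ into a free abelian monoid $D$ such that $\varphi(a)\mid\varphi(b)$ in $D$ implies $a\mid b$ in $H$. A monoid homomorphism $\theta\colon H\to B$ is a transfer homomorphism if (T1) $B=\theta(H)B^\times$ and $\theta^{-1}(B^\times)=H^\times$; (T2) if $u\in H$, $b,c\in B$ and $\theta(u)=bc$, then there are $v,w\in H$ with $u=vw$, $\theta(v)\in bB^\times$, $\theta(w)\in cB^\times$. $H$ is transfer Krull if there is a transfer homomorphism from $H$ to a Krull monoid. *)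

theory Defs
  imports "HOL-Algebra.Algebra" "HOL-Library.Multiset" "HOL-Library.Infinite_Typeclass"
begin

section \<open>Sequences over a group\<close>

definition free_abelian_monoid :: "'a set \<Rightarrow> 'a multiset monoid" where
  "free_abelian_monoid P = \<lparr>carrier = {S. set_mset S \<subseteq> P}, monoid.mult = (+), one = {#}\<rparr>"

text \<open>The abelian group \<^term>\<open>G\<close> is written multiplicatively, as usual in HOL-Algebra, so a zero-sum
  condition becomes a condition on \<^const>\<open>finprod\<close>.\<close>

definition B_Gamma :: "('g, 'm) monoid_scheme \<Rightarrow> ('g \<Rightarrow> 'g) set \<Rightarrow> 'g multiset monoid" where
  "B_Gamma G \<Gamma> = (free_abelian_monoid (carrier G))
     \<lparr>carrier := {mset gs | gs. set gs \<subseteq> carrier G \<and>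
        (\<exists>\<gamma> \<in> {..<length gs} \<rightarrow> \<Gamma>. (\<Otimes>\<^bsub>G\<^esub>i \<in> {..<length gs}. \<gamma> i (gs ! i)) = \<one>\<^bsub>G\<^esub>)}\<rparr>"

definition elementary_2_group :: "('g, 'm) monoid_scheme \<Rightarrow> bool" where
  "elementary_2_group G \<longleftrightarrow> comm_group G \<and> (\<forall>g \<in> carrier G. g \<otimes>\<^bsub>G\<^esub> g = \<one>\<^bsub>G\<^esub>)"

section \<open>Quotient group and root closure\<close>

text \<open>A monoid in the sense of this theory is a \<^locale>\<open>comm_monoid_cancel\<close>. Its quotient group consists
  of the classes of pairs, the class \<^term>\<open>fraction H a s\<close> being the fraction with numerator \<^term>\<open>a\<close> and
  denominator \<^term>\<open>s\<close>. Inside the quotient group, \<^term>\<open>H\<close> is represented by the image of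
  \<^term>\<open>quot_emb H\<close>.\<close>

definition fraction :: "('a, 'm) monoid_scheme \<Rightarrow> 'a \<Rightarrow> 'a \<Rightarrow> ('a \<times> 'a) set" where
  "fraction H a s = {(b, t) \<in> carrier H \<times> carrier H. a \<otimes>\<^bsub>H\<^esub> t = b \<otimes>\<^bsub>H\<^esub> s}"

definition quot_group :: "('a, 'm) monoid_scheme \<Rightarrow> ('a \<times> 'a) set monoid" where
  "quot_group H =
     \<lparr>carrier = {fraction H a s | a s. a \<in> carrier H \<and> s \<in> carrier H},
      monoid.mult = (\<lambda>U V. \<Union>(a, s) \<in> U. \<Union>(b, t) \<in> V. fraction H (a \<otimes>\<^bsub>H\<^esub> b) (s \<otimes>\<^bsub>H\<^esub> t)),
      one = fraction H \<one>\<^bsub>H\<^esub> \<one>\<^bsub>H\<^esub>\<rparr>"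

definition quot_emb :: "('a, 'm) monoid_scheme \<Rightarrow> 'a \<Rightarrow> ('a \<times> 'a) set" where
  "quot_emb H a = fraction H a \<one>\<^bsub>H\<^esub>"

definition root_closed :: "('a, 'm) monoid_scheme \<Rightarrow> bool" where
  "root_closed H \<longleftrightarrow> comm_monoid_cancel H \<and>
     (\<forall>x \<in> carrier (quot_group H). \<forall>n :: nat. n \<ge> 1 \<longrightarrow>
        x [^]\<^bsub>quot_group H\<^esub> n \<in> quot_emb H ` carrier H \<longrightarrow> x \<in> quot_emb H ` carrier H)"

section \<open>Prime s-ideals, weakly Krull monoids and Krull monoids\<close>

definition s_ideal :: "('a, 'm) monoid_scheme \<Rightarrow> 'a set \<Rightarrow> bool" where
  "s_ideal H I \<longleftrightarrow> I \<subseteq> carrier H \<and> (\<forall>a \<in> I. \<forall>h \<in> carrier H. a \<otimes>\<^bsub>H\<^esub> h \<in> I)"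

definition prime_s_ideal :: "('a, 'm) monoid_scheme \<Rightarrow> 'a set \<Rightarrow> bool" where
  "prime_s_ideal H \<pp> \<longleftrightarrow> s_ideal H \<pp> \<and> \<pp> \<subset> carrier H \<and>
     (\<forall>a \<in> carrier H - \<pp>. \<forall>b \<in> carrier H - \<pp>. a \<otimes>\<^bsub>H\<^esub> b \<in> carrier H - \<pp>)"

definition min_primes :: "('a, 'm) monoid_scheme \<Rightarrow> 'a set set" where
  "min_primes H = {\<pp>. prime_s_ideal H \<pp> \<and> \<pp> \<noteq> {} \<and>
     (\<forall>\<qq>. prime_s_ideal H \<qq> \<and> \<qq> \<noteq> {} \<and> \<qq> \<subseteq> \<pp> \<longrightarrow> \<qq> = \<pp>)}"

definition localization :: "('a, 'm) monoid_scheme \<Rightarrow> 'a set \<Rightarrow> ('a \<times> 'a) set monoid" where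
  "localization H \<pp> =
     (quot_group H)\<lparr>carrier := {fraction H a s | a s. a \<in> carrier H \<and> s \<in> carrier H - \<pp>}\<rparr>"

text \<open>The intersection is taken inside the quotient group, so a monoid without nonempty prime s-ideals
  (i.e. a group) is weakly Krull.\<close>

definition weakly_Krull :: "('a, 'm) monoid_scheme \<Rightarrow> bool" where
  "weakly_Krull H \<longleftrightarrow> comm_monoid_cancel H \<and>
     quot_emb H ` carrier H =
       carrier (quot_group H) \<inter> (\<Inter>\<pp> \<in> min_primes H. carrier (localization H \<pp>)) \<and>
     (\<forall>a \<in> carrier H. finite {\<pp> \<in> min_primes H. a \<in> \<pp>})"

definition reduced_monoid :: "('a, 'm) monoid_scheme \<Rightarrow> 'a set monoid" where
  "reduced_monoid H = \<lparr>carrier = (\<lambda>a. a <#\<^bsub>H\<^esub> Units H) ` carrier H, monoid.mult = set_mult H, one = Units H\<rparr>"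

text \<open>A discrete valuation monoid is one whose reduced monoid is isomorphic to the additive monoid of the
  natural numbers; in particular it is not a group.\<close>

definition discrete_valuation_monoid :: "('a, 'm) monoid_scheme \<Rightarrow> bool" where
  "discrete_valuation_monoid H \<longleftrightarrow> comm_monoid_cancel H \<and>
     reduced_monoid H \<cong> \<lparr>carrier = (UNIV :: nat set), monoid.mult = (+), one = 0\<rparr>"

definition Krull :: "('a, 'm) monoid_scheme \<Rightarrow> bool" where
  "Krull H \<longleftrightarrow> weakly_Krull H \<and>
     (\<forall>\<pp> \<in> min_primes H. discrete_valuation_monoid (localization H \<pp>))"

section \<open>Transfer homomorphisms\<close>

definition transfer_hom ::
  "('a, 'm) monoid_scheme \<Rightarrow> ('b, 'n) monoid_scheme \<Rightarrow> ('a \<Rightarrow> 'b) \<Rightarrow> bool" where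
  "transfer_hom H B \<theta> \<longleftrightarrow>
     comm_monoid_cancel H \<and> comm_monoid_cancel B \<and> \<theta> \<in> hom H B \<and> \<theta> \<one>\<^bsub>H\<^esub> = \<one>\<^bsub>B\<^esub> \<and>
     carrier B = \<theta> ` carrier H <#>\<^bsub>B\<^esub> Units B \<and>
     {a \<in> carrier H. \<theta> a \<in> Units B} = Units H \<and>
     (\<forall>u \<in> carrier H. \<forall>b \<in> carrier B. \<forall>c \<in> carrier B. \<theta> u = b \<otimes>\<^bsub>B\<^esub> c \<longrightarrow>
        (\<exists>v \<in> carrier H. \<exists>w \<in> carrier H. u = v \<otimes>\<^bsub>H\<^esub> w \<and>
           \<theta> v \<in> b <#\<^bsub>B\<^esub> Units B \<and> \<theta> w \<in> c <#\<^bsub>B\<^esub> Units B))"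

text \<open>HOL cannot quantify over the type of the target monoid inside a formula, so that type is a
  parameter. Every monoid has a copy whose carrier lies in some infinite type. A transfer Krull monoid
  \<^term>\<open>H\<close> has a transfer homomorphism onto a reduced Krull monoid, which is no larger than \<^term>\<open>H\<close>.
  Thus, for a countable \<^term>\<open>H\<close>, such as \<^const>\<open>B_Gamma\<close> of a finite group, every infinite type
  gives the same notion, namely the one with targets of arbitrary type.\<close>

definition transfer_Krull :: "'b itself \<Rightarrow> ('a, 'm) monoid_scheme \<Rightarrow> bool" where
  "transfer_Krull _ H \<longleftrightarrow> (\<exists>(B :: 'b monoid) \<theta>. Krull B \<and> transfer_hom H B \<theta>)"

end

theory Submission
  imports Defs
begin

text \<open>
  The monoid \<open>B = \<B>\<^sub>\<Gamma>(G)\<close> lies in the free abelian monoid \<open>F\<close> over \<open>G\<close>, and since both weights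
  \<open>id\<close> and \<open>-id\<close> are available, \<open>S\<^sup>2 \<in> B\<close> for every \<open>S \<in> F\<close>. With \<open>G\<close>
  written additively and sequences as products, everything turns on whether \<open>B\<close> is saturated in \<open>F\<close>,
  that is, whether \<open>T \<in> B\<close> and \<open>x T \<in> B\<close> force \<open>x \<in> B\<close>.

  If \<open>G\<close> is an elementary 2-group and the only weight is the identity, then \<open>B\<close> is the kernel of the
  summation homomorphism \<open>F \<rightarrow> G\<close>, so divisibility in \<open>B\<close> is divisibility in \<open>F\<close>, read off from
  multiplicities. The locale \<open>torsion_valuations\<close> derives from such data root closedness and the Krull
  property; the elements \<open>g\<^sup>2\<close> make the minimal primes explicit. A Krull monoid is transfer Krull through
  an isomorphic copy, which fits into any infinite type because \<open>B\<close> is countable.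

  For all other groups and sets of weights, lemma \<open>obstruction\<close> finds nonzero \<open>x, y \<in> G\<close> such that \<open>x y\<^sup>2 \<in> B\<close>, while
  \<open>x \<notin> B\<close> because automorphisms preserve being nonzero. If \<open>2g \<noteq> 0\<close>, take \<open>x = 2g\<close> and \<open>y = g\<close>; if
  all elements have order at most 2 but \<open>\<gamma>(g) \<noteq> g\<close> for some \<open>\<gamma> \<in> \<Gamma>\<close>, take \<open>x = g + \<gamma>(g)\<close> and
  \<open>y = g\<close>. This one element of the quotient group, \<open>x = x y\<^sup>2 / y\<^sup>2\<close>, contradicts each remaining
  property:
  \<^item> \<open>x\<^sup>2 \<in> B\<close>, so \<open>B\<close> is not root closed.
  \<^item> A minimal prime that contains \<open>y\<^sup>2\<close> is \<open>{S \<in> B. y \<in> S}\<close>. There is a second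
    denominator \<open>T \<in> B\<close> with \<open>x T \<in> B\<close> in which \<open>y\<close> does not occur. Hence \<open>x\<close> lies in every
    localization, and \<open>B\<close> is not weakly Krull.
  \<^item> Let \<open>\<theta>\<close> be a transfer homomorphism to a Krull monoid. From \<open>(x y\<^sup>2)\<^sup>2 = x\<^sup>2 (y\<^sup>2)\<^sup>2\<close> it follows
    that \<open>\<theta>(y\<^sup>2)\<close> divides \<open>\<theta>(x y\<^sup>2)\<close>, because Krull monoids are root closed. Lifting this factorization
    would split \<open>x y\<^sup>2\<close> into two nonunits of \<open>B\<close>. One of them would have length 1, hence be the zero
    element of \<open>G\<close>, but neither \<open>x\<close> nor \<open>y\<close> is zero.
\<close>

section \<open>Fractions and localizations\<close>

context comm_monoid_cancel
begin

lemma fraction_eq_iff: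
  assumes "a \<in> carrier G" "s \<in> carrier G" "b \<in> carrier G" "t \<in> carrier G"
  shows "fraction G a s = fraction G b t \<longleftrightarrow> a \<otimes> t = b \<otimes> s"
proof
  assume "fraction G a s = fraction G b t"
  moreover have "(b, t) \<in> fraction G b t"
    using assms by (simp add: fraction_def)
  ultimately show "a \<otimes> t = b \<otimes> s"
    by (auto simp: fraction_def)
next
  assume eq: "a \<otimes> t = b \<otimes> s"
  have "a \<otimes> r = c \<otimes> s \<longleftrightarrow> b \<otimes> r = c \<otimes> t" if "c \<in> carrier G" "r \<in> carrier G" for c r
  proof -
    have "(a \<otimes> r) \<otimes> t = (a \<otimes> t) \<otimes> r" "(b \<otimes> r) \<otimes> s = (b \<otimes> s) \<otimes> r"
      "(c \<otimes> s) \<otimes> t = (c \<otimes> t) \<otimes> s"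
      using assms that by (simp_all add: m_ac)
    then have "(a \<otimes> r) \<otimes> t = (c \<otimes> s) \<otimes> t \<longleftrightarrow> (b \<otimes> r) \<otimes> s = (c \<otimes> t) \<otimes> s"
      using eq by simp
    moreover have "(a \<otimes> r) \<otimes> t = (c \<otimes> s) \<otimes> t \<longleftrightarrow> a \<otimes> r = c \<otimes> s"
      using r_cancel[of "a \<otimes> r" t "c \<otimes> s"] assms that by (metis m_closed)
    moreover have "(b \<otimes> r) \<otimes> s = (c \<otimes> t) \<otimes> s \<longleftrightarrow> b \<otimes> r = c \<otimes> t"
      using r_cancel[of "b \<otimes> r" s "c \<otimes> t"] assms that by (metis m_closed)
    ultimately show ?thesis
      by simp
  qed
  then show "fraction G a s = fraction G b t"
    by (auto simp: fraction_def)
qed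

lemma fraction_mult:
  assumes "a \<in> carrier G" "s \<in> carrier G" "b \<in> carrier G" "t \<in> carrier G"
  shows "fraction G a s \<otimes>\<^bsub>quot_group G\<^esub> fraction G b t = fraction G (a \<otimes> b) (s \<otimes> t)"
proof -
  have eq: "fraction G (a' \<otimes> b') (s' \<otimes> t') = fraction G (a \<otimes> b) (s \<otimes> t)"
    if "(a', s') \<in> fraction G a s" "(b', t') \<in> fraction G b t" for a' s' b' t'
  proof -
    have in_G: "a' \<in> carrier G" "s' \<in> carrier G" "b' \<in> carrier G" "t' \<in> carrier G"
      and "a \<otimes> s' = a' \<otimes> s" "b \<otimes> t' = b' \<otimes> t"
      using that by (auto simp: fraction_def)
    then have "(a' \<otimes> s) \<otimes> (b' \<otimes> t) = (a \<otimes> s') \<otimes> (b \<otimes> t')"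
      by simp
    then have "(a' \<otimes> b') \<otimes> (s \<otimes> t) = (a \<otimes> b) \<otimes> (s' \<otimes> t')"
      using assms in_G by (simp add: m_ac)
    then show ?thesis
      using assms in_G by (subst fraction_eq_iff) auto
  qed
  have "(a, s) \<in> fraction G a s" "(b, t) \<in> fraction G b t"
    using assms by (auto simp: fraction_def)
  with eq have "(\<Union>(a', s') \<in> fraction G a s. \<Union>(b', t') \<in> fraction G b t.
      fraction G (a' \<otimes> b') (s' \<otimes> t')) = fraction G (a \<otimes> b) (s \<otimes> t)"
    by fast
  then show ?thesis
    by (simp add: quot_group_def)
qed

lemma fraction_nat_pow:
  assumes "a \<in> carrier G" "s \<in> carrier G"
  shows "fraction G a s [^]\<^bsub>quot_group G\<^esub> (n :: nat) = fraction G (a [^] n) (s [^] n)"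
proof (induction n)
  case 0
  show ?case by (simp add: nat_pow_def quot_group_def)
next
  case (Suc n)
  have "fraction G a s [^]\<^bsub>quot_group G\<^esub> Suc n
      = fraction G a s [^]\<^bsub>quot_group G\<^esub> n \<otimes>\<^bsub>quot_group G\<^esub> fraction G a s"
    by (simp add: nat_pow_def)
  then show ?case
    using Suc assms by (simp add: fraction_mult)
qed

lemma quot_emb_eq_fraction_iff:
  assumes "a \<in> carrier G" "s \<in> carrier G" "c \<in> carrier G"
  shows "quot_emb G c = fraction G a s \<longleftrightarrow> a = s \<otimes> c"
  using assms unfolding quot_emb_def by (subst fraction_eq_iff) (auto simp: m_comm)

lemma fraction_in_quot_emb_iff:
  assumes "a \<in> carrier G" "s \<in> carrier G"
  shows "fraction G a s \<in> quot_emb G ` carrier G \<longleftrightarrow> (\<exists>c \<in> carrier G. a = s \<otimes> c)"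
  using quot_emb_eq_fraction_iff[OF assms] by auto

lemma prime_s_ideal_one:
  assumes "prime_s_ideal G \<pp>"
  shows "\<one> \<notin> \<pp>"
proof
  assume "\<one> \<in> \<pp>"
  then have "\<forall>h \<in> carrier G. \<one> \<otimes> h \<in> \<pp>"
    using assms unfolding prime_s_ideal_def s_ideal_def by blast
  then show False
    using assms unfolding prime_s_ideal_def by auto
qed

lemma prime_s_ideal_pow:
  assumes "prime_s_ideal G \<pp>" "a \<in> carrier G" "a [^] (n :: nat) \<in> \<pp>"
  shows "a \<in> \<pp>"
  using assms(3)
proof (induction n)
  case 0
  then show ?case
    using prime_s_ideal_one[OF assms(1)] by simp
next
  case (Suc n)
  then show ?case
    using assms(1,2) unfolding prime_s_ideal_def by (metis Diff_iff nat_pow_Suc nat_pow_closed)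
qed

lemma comm_monoid_cancel_localization:
  assumes "prime_s_ideal G \<pp>"
  shows "comm_monoid_cancel (localization G \<pp>)"
proof -
  let ?L = "localization G \<pp>"
  have one: "\<one> \<in> carrier G - \<pp>"
    using prime_s_ideal_one[OF assms] by simp
  have closed: "s \<otimes> t \<in> carrier G - \<pp>" if "s \<in> carrier G - \<pp>" "t \<in> carrier G - \<pp>" for s t
    using assms that unfolding prime_s_ideal_def by blast
  have carr: "carrier ?L = {fraction G a s | a s. a \<in> carrier G \<and> s \<in> carrier G - \<pp>}"
    by (simp add: localization_def)
  have mult: "fraction G a s \<otimes>\<^bsub>?L\<^esub> fraction G b t = fraction G (a \<otimes> b) (s \<otimes> t)"
    if "a \<in> carrier G" "s \<in> carrier G" "b \<in> carrier G" "t \<in> carrier G" for a s b t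
    using fraction_mult[OF that] by (simp add: localization_def)
  have unit: "\<one>\<^bsub>?L\<^esub> = fraction G \<one> \<one>"
    by (simp add: localization_def quot_group_def)
  show ?thesis
  proof (rule comm_monoid_cancelI)
    show "comm_monoid ?L"
    proof (rule comm_monoidI)
      fix x y assume "x \<in> carrier ?L" "y \<in> carrier ?L"
      then obtain a s b t where "x = fraction G a s" "y = fraction G b t"
        "a \<in> carrier G" "s \<in> carrier G - \<pp>" "b \<in> carrier G" "t \<in> carrier G - \<pp>"
        unfolding carr by auto
      then show "x \<otimes>\<^bsub>?L\<^esub> y \<in> carrier ?L" "x \<otimes>\<^bsub>?L\<^esub> y = y \<otimes>\<^bsub>?L\<^esub> x"
        using closed[of s t] unfolding carr by (auto simp: mult m_comm)
    next
      show "\<one>\<^bsub>?L\<^esub> \<in> carrier ?L"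
        using one unfolding carr unit by auto
    next
      fix x y z assume "x \<in> carrier ?L" "y \<in> carrier ?L" "z \<in> carrier ?L"
      then show "(x \<otimes>\<^bsub>?L\<^esub> y) \<otimes>\<^bsub>?L\<^esub> z = x \<otimes>\<^bsub>?L\<^esub> (y \<otimes>\<^bsub>?L\<^esub> z)"
        unfolding carr by (auto simp: mult m_assoc)
    next
      fix x assume "x \<in> carrier ?L"
      then show "\<one>\<^bsub>?L\<^esub> \<otimes>\<^bsub>?L\<^esub> x = x"
        unfolding carr unit by (auto simp: mult)
    qed
  next
    fix x y z
    assume *: "x \<otimes>\<^bsub>?L\<^esub> z = y \<otimes>\<^bsub>?L\<^esub> z" "x \<in> carrier ?L" "y \<in> carrier ?L" "z \<in> carrier ?L"
    then obtain a s b t c r where eq: "x = fraction G a s" "y = fraction G b t" "z = fraction G c r"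
      and in_G: "a \<in> carrier G" "s \<in> carrier G" "b \<in> carrier G" "t \<in> carrier G"
        "c \<in> carrier G" "r \<in> carrier G"
      unfolding carr by auto
    have "(a \<otimes> c) \<otimes> (t \<otimes> r) = (b \<otimes> c) \<otimes> (s \<otimes> r)"
      using *(1) in_G unfolding eq by (simp add: mult fraction_eq_iff)
    then have "(c \<otimes> r) \<otimes> (a \<otimes> t) = (c \<otimes> r) \<otimes> (b \<otimes> s)"
      using in_G by (simp add: m_ac)
    then have "a \<otimes> t = b \<otimes> s"
      using in_G l_cancel[of "c \<otimes> r" "a \<otimes> t" "b \<otimes> s"] by simp
    then show "x = y"
      using in_G unfolding eq by (simp add: fraction_eq_iff)
  qed
qed

end

section \<open>Discrete valuation monoids and divisibility in Krull monoids\<close>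

lemma (in comm_monoid_cancel) coset_Units_mult:
  assumes "x \<in> carrier G" "y \<in> carrier G"
  shows "(x <# Units G) <#> (y <# Units G) = (x \<otimes> y) <# Units G"
proof
  show "(x <# Units G) <#> (y <# Units G) \<subseteq> (x \<otimes> y) <# Units G"
  proof
    fix z assume "z \<in> (x <# Units G) <#> (y <# Units G)"
    then obtain u v where uv: "u \<in> Units G" "v \<in> Units G" and z: "z = (x \<otimes> u) \<otimes> (y \<otimes> v)"
      unfolding set_mult_def l_coset_def by auto
    then have "z = (x \<otimes> y) \<otimes> (u \<otimes> v)"
      using assms by (simp add: m_ac Units_closed)
    then show "z \<in> (x \<otimes> y) <# Units G"
      using uv unfolding l_coset_def by auto
  qed
next
  show "(x \<otimes> y) <# Units G \<subseteq> (x <# Units G) <#> (y <# Units G)"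
  proof
    fix z assume "z \<in> (x \<otimes> y) <# Units G"
    then obtain u where u: "u \<in> Units G" and z: "z = (x \<otimes> y) \<otimes> u"
      unfolding l_coset_def by auto
    then have "z = (x \<otimes> \<one>) \<otimes> (y \<otimes> u)"
      using assms by (simp add: m_ac Units_closed)
    then show "z \<in> (x <# Units G) <#> (y <# Units G)"
      using u unfolding set_mult_def l_coset_def by blast
  qed
qed

lemma (in comm_monoid_cancel) coset_Units_absorb:
  assumes "x \<in> carrier G" "e \<in> Units G"
  shows "(x \<otimes> e) <# Units G = x <# Units G"
proof -
  have expand: "x \<otimes> u = (x \<otimes> e) \<otimes> (inv e \<otimes> u)" if "u \<in> Units G" for u
  proof -
    have "(x \<otimes> e) \<otimes> (inv e \<otimes> u) = x \<otimes> ((e \<otimes> inv e) \<otimes> u)"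
      using assms that by (simp only: m_assoc Units_closed Units_inv_closed m_closed)
    then show ?thesis
      using assms that by (simp add: Units_closed)
  qed
  have collect: "(x \<otimes> e) \<otimes> u = x \<otimes> (e \<otimes> u)" if "u \<in> Units G" for u
    using assms that by (simp add: m_assoc Units_closed)
  show ?thesis
  proof
    show "(x \<otimes> e) <# Units G \<subseteq> x <# Units G"
      using assms collect unfolding l_coset_def by blast
    show "x <# Units G \<subseteq> (x \<otimes> e) <# Units G"
    proof
      fix z assume "z \<in> x <# Units G"
      then have "\<exists>u \<in> Units G. z = x \<otimes> u"
        unfolding l_coset_def by simp
      then obtain u where u: "u \<in> Units G" "z = x \<otimes> u" ..
      then have "inv e \<otimes> u \<in> Units G" "z = (x \<otimes> e) \<otimes> (inv e \<otimes> u)"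
        using assms expand[OF u(1)] by auto
      then show "z \<in> (x \<otimes> e) <# Units G"
        unfolding l_coset_def by (intro UN_I) auto
    qed
  qed
qed

text \<open>This trades the cosets of the unit group for a valuation, in terms of which divisibility is a
  comparison of natural numbers. The valuation is constant on cosets of units, and two elements of equal
  value are associated because each divides the other.\<close>

lemma discrete_valuation_monoid_iff:
  "discrete_valuation_monoid M \<longleftrightarrow> comm_monoid_cancel M \<and>
     (\<exists>w :: 'a \<Rightarrow> nat. (\<forall>x \<in> carrier M. \<forall>y \<in> carrier M. w (x \<otimes>\<^bsub>M\<^esub> y) = w x + w y) \<and>
        w ` carrier M = UNIV \<and>
        (\<forall>x \<in> carrier M. \<forall>y \<in> carrier M. w x \<le> w y \<longrightarrow> (\<exists>z \<in> carrier M. y = x \<otimes>\<^bsub>M\<^esub> z)))"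
    (is "_ \<longleftrightarrow> _ \<and> (\<exists>w. ?valuation w)")
proof (cases "comm_monoid_cancel M")
  case True
  then interpret M: comm_monoid_cancel M .
  let ?U = "Units M" and ?N = "\<lparr>carrier = (UNIV :: nat set), monoid.mult = (+), one = 0\<rparr>"
  have "reduced_monoid M \<cong> ?N \<longleftrightarrow> (\<exists>w. ?valuation w)"
  proof
    assume "reduced_monoid M \<cong> ?N"
    then obtain h where h: "h \<in> iso (reduced_monoid M) ?N"
      unfolding is_iso_def by auto
    define w where "w x = h (x <#\<^bsub>M\<^esub> ?U)" for x
    have hom: "w (x \<otimes>\<^bsub>M\<^esub> y) = w x + w y" if "x \<in> carrier M" "y \<in> carrier M" for x y
    proof -
      have "h ((x <#\<^bsub>M\<^esub> ?U) <#>\<^bsub>M\<^esub> (y <#\<^bsub>M\<^esub> ?U)) = w x + w y"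
        using h that unfolding w_def iso_def hom_def reduced_monoid_def by simp
      then show ?thesis
        using M.coset_Units_mult[OF that] by (simp add: w_def)
    qed
    have bij: "bij_betw h ((\<lambda>a. a <#\<^bsub>M\<^esub> ?U) ` carrier M) UNIV"
      using h unfolding iso_def reduced_monoid_def by simp
    have surj: "w ` carrier M = UNIV"
      using bij_betw_imp_surj_on[OF bij] unfolding w_def by (simp add: image_image)
    have "\<exists>z \<in> carrier M. y = x \<otimes>\<^bsub>M\<^esub> z"
      if xy: "x \<in> carrier M" "y \<in> carrier M" "w x \<le> w y" for x y
    proof -
      obtain z where z: "z \<in> carrier M" "w z = w y - w x"
        using surj by (metis UNIV_I imageE)
      then have "w (x \<otimes>\<^bsub>M\<^esub> z) = w y"
        using hom xy by simp
      then have "(x \<otimes>\<^bsub>M\<^esub> z) <#\<^bsub>M\<^esub> ?U = y <#\<^bsub>M\<^esub> ?U"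
        using bij_betw_imp_inj_on[OF bij] xy z unfolding w_def by (auto simp: inj_on_def)
      moreover have "y \<in> y <#\<^bsub>M\<^esub> ?U"
        using xy unfolding l_coset_def by force
      ultimately obtain u where "u \<in> ?U" "y = x \<otimes>\<^bsub>M\<^esub> z \<otimes>\<^bsub>M\<^esub> u"
        unfolding l_coset_def by auto
      then show ?thesis
        using xy z by (intro bexI[of _ "z \<otimes>\<^bsub>M\<^esub> u"]) (auto simp: M.m_assoc M.Units_closed)
    qed
    then show "\<exists>w. ?valuation w"
      using hom surj by blast
  next
    assume "\<exists>w. ?valuation w"
    then obtain w where w: "?valuation w" ..
    then have hom: "w (x \<otimes>\<^bsub>M\<^esub> y) = w x + w y" if "x \<in> carrier M" "y \<in> carrier M" for x y
      using that by simp
    from w have surj: "w ` carrier M = UNIV"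
      by simp
    from w have dvd: "\<exists>z \<in> carrier M. y = x \<otimes>\<^bsub>M\<^esub> z"
      if "x \<in> carrier M" "y \<in> carrier M" "w x \<le> w y" for x y
      using that by simp
    have w_one: "w \<one>\<^bsub>M\<^esub> = 0"
      using hom[of "\<one>\<^bsub>M\<^esub>" "\<one>\<^bsub>M\<^esub>"] by simp
    have w_unit: "w u = 0" if "u \<in> ?U" for u
      using that hom[of u "inv\<^bsub>M\<^esub> u"] w_one by (simp add: M.Units_closed)
    define h where "h C = w (SOME x. x \<in> C)" for C
    have h: "h (x <#\<^bsub>M\<^esub> ?U) = w x" if "x \<in> carrier M" for x
    proof -
      have "\<exists>y. y \<in> x <#\<^bsub>M\<^esub> ?U"
        unfolding l_coset_def by auto
      then have "(SOME y. y \<in> x <#\<^bsub>M\<^esub> ?U) \<in> x <#\<^bsub>M\<^esub> ?U"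
        by (rule someI_ex)
      then have "\<exists>u \<in> ?U. (SOME y. y \<in> x <#\<^bsub>M\<^esub> ?U) = x \<otimes>\<^bsub>M\<^esub> u"
        unfolding l_coset_def by simp
      then obtain u where "u \<in> ?U" "(SOME y. y \<in> x <#\<^bsub>M\<^esub> ?U) = x \<otimes>\<^bsub>M\<^esub> u" ..
      then show ?thesis
        using that hom[of x u] w_unit[of u] unfolding h_def by (simp add: M.Units_closed)
    qed
    have inj: "x <#\<^bsub>M\<^esub> ?U = y <#\<^bsub>M\<^esub> ?U" 
      if xy: "x \<in> carrier M" "y \<in> carrier M" "w x = w y" for x y
    proof -
      obtain z where z: "z \<in> carrier M" "y = x \<otimes>\<^bsub>M\<^esub> z"
        using dvd[of x y] xy(1,2) eq_imp_le[OF xy(3)] by blast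
      have "w z = 0"
        using hom[OF xy(1) z(1)] xy(3) z(2) by simp
      then obtain z' where "z' \<in> carrier M" "\<one>\<^bsub>M\<^esub> = z \<otimes>\<^bsub>M\<^esub> z'"
        using dvd[of z "\<one>\<^bsub>M\<^esub>"] z(1) by auto
      then have "z \<in> ?U"
        using z(1) M.m_comm[of z z'] unfolding Units_def by force
      then show ?thesis
        using M.coset_Units_absorb[of x z] xy(1) z(2) by simp
    qed
    have "h \<in> iso (reduced_monoid M) ?N"
      unfolding iso_def hom_def bij_betw_def
    proof (intro CollectI conjI)
      show "inj_on h (carrier (reduced_monoid M))"
      proof (rule inj_onI)
        fix C D assume "C \<in> carrier (reduced_monoid M)" "D \<in> carrier (reduced_monoid M)" "h C = h D"
        then obtain x y where xy: "x \<in> carrier M" "y \<in> carrier M"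
          "C = x <#\<^bsub>M\<^esub> ?U" "D = y <#\<^bsub>M\<^esub> ?U"
          unfolding reduced_monoid_def by auto
        then show "C = D"
          using inj[OF xy(1,2)] h[OF xy(1)] h[OF xy(2)] \<open>h C = h D\<close> by simp
      qed
      have "h ` ((\<lambda>a. a <#\<^bsub>M\<^esub> ?U) ` carrier M) = w ` carrier M"
        using h by (simp add: image_image)
      then show "h ` carrier (reduced_monoid M) = carrier ?N"
        using surj by (simp add: reduced_monoid_def)
    qed (auto simp: reduced_monoid_def M.coset_Units_mult h hom)
    then show "reduced_monoid M \<cong> ?N"
      unfolding is_iso_def by auto
  qed
  then show ?thesis
    using True unfolding discrete_valuation_monoid_def by simp
qed (simp add: discrete_valuation_monoid_def)

text \<open>Since the valuation of each localization doubles on squares, \<open>u\<close> divides \<open>v\<close> in every localization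
  at a minimal prime; so \<open>v/u\<close> lies in the intersection of the localizations, which is \<open>H\<close>.\<close>

lemma Krull_dvd_of_square_dvd:
  assumes "Krull H" and in_H: "u \<in> carrier H" "v \<in> carrier H" "c \<in> carrier H"
    and sq: "v \<otimes>\<^bsub>H\<^esub> v = c \<otimes>\<^bsub>H\<^esub> (u \<otimes>\<^bsub>H\<^esub> u)"
  shows "\<exists>z \<in> carrier H. v = u \<otimes>\<^bsub>H\<^esub> z"
proof -
  from assms have wK: "weakly_Krull H"
    and dvm: "\<And>\<pp>. \<pp> \<in> min_primes H \<Longrightarrow> discrete_valuation_monoid (localization H \<pp>)"
    unfolding Krull_def by auto
  from wK interpret H: comm_monoid_cancel H
    unfolding weakly_Krull_def by simp
  have "fraction H v u \<in> carrier (localization H \<pp>)" if p: "\<pp> \<in> min_primes H" for \<pp>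
  proof -
    let ?L = "localization H \<pp>" and ?e = "quot_emb H"
    have prime: "prime_s_ideal H \<pp>"
      using p unfolding min_primes_def by simp
    have emb: "?e x \<in> carrier ?L" if "x \<in> carrier H" for x
      using that H.prime_s_ideal_one[OF prime] unfolding quot_emb_def localization_def by auto
    have emb_mult: "?e x \<otimes>\<^bsub>?L\<^esub> ?e y = ?e (x \<otimes>\<^bsub>H\<^esub> y)" if "x \<in> carrier H" "y \<in> carrier H" for x y
      using that H.fraction_mult[of x "\<one>\<^bsub>H\<^esub>" y "\<one>\<^bsub>H\<^esub>"] unfolding quot_emb_def localization_def
      by simp
    obtain w :: "_ \<Rightarrow> nat"
      where hom: "\<forall>x \<in> carrier ?L. \<forall>y \<in> carrier ?L. w (x \<otimes>\<^bsub>?L\<^esub> y) = w x + w y"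
      and dvd: "\<forall>x \<in> carrier ?L. \<forall>y \<in> carrier ?L. w x \<le> w y \<longrightarrow>
        (\<exists>z \<in> carrier ?L. y = x \<otimes>\<^bsub>?L\<^esub> z)"
      using dvm[OF p] unfolding discrete_valuation_monoid_iff by auto
    have "w (?e (x \<otimes>\<^bsub>H\<^esub> y)) = w (?e x) + w (?e y)" if "x \<in> carrier H" "y \<in> carrier H" for x y
      using hom emb that by (simp flip: emb_mult)
    then have "w (?e v) + w (?e v) = w (?e c) + (w (?e u) + w (?e u))"
      using arg_cong[OF sq, of "\<lambda>x. w (?e x)"] in_H by simp
    then have "w (?e u) \<le> w (?e v)"
      by linarith
    then obtain z where z: "z \<in> carrier ?L" "?e v = ?e u \<otimes>\<^bsub>?L\<^esub> z"
      using dvd emb in_H by blast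
    then obtain b t where bt: "b \<in> carrier H" "t \<in> carrier H - \<pp>" "z = fraction H b t"
      unfolding localization_def by auto
    then have "fraction H v \<one>\<^bsub>H\<^esub> = fraction H (u \<otimes>\<^bsub>H\<^esub> b) t"
      using z(2) in_H H.fraction_mult[of u "\<one>\<^bsub>H\<^esub>" b t]
      unfolding quot_emb_def localization_def by simp
    then have "v \<otimes>\<^bsub>H\<^esub> t = u \<otimes>\<^bsub>H\<^esub> b"
      using in_H bt by (simp add: H.fraction_eq_iff)
    then have "fraction H v u = fraction H b t"
      using in_H bt by (simp add: H.fraction_eq_iff H.m_comm)
    then show ?thesis
      using bt unfolding localization_def by auto
  qed
  moreover have "fraction H v u \<in> carrier (quot_group H)"
    using in_H unfolding quot_group_def by auto
  ultimately have "fraction H v u \<in> quot_emb H ` carrier H"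
    using wK unfolding weakly_Krull_def by auto
  then show ?thesis
    using in_H by (simp add: H.fraction_in_quot_emb_iff)
qed

section \<open>A valuation criterion for Krull monoids\<close>

text \<open>The assumptions describe a divisor homomorphism into a free abelian monoid over \<open>P\<close> in which
  every \<open>p \<in> P\<close> is the support of some element. Such elements exist when the class group is torsion; they
  replace the usual approximation argument, since elements with prescribed lower bounds on
  finitely many valuations, and value 0 elsewhere, can be built as products. The valuations need not
  be normalized: a group of order 2 has a nonzero element that occurs in its zero-sum sequences only with
  even multiplicity.\<close>

locale torsion_valuations = comm_monoid_cancel G for G (structure) +
  fixes P :: "'p set" and v :: "'p \<Rightarrow> 'a \<Rightarrow> nat"
  assumes v_mult: "p \<in> P \<Longrightarrow> a \<in> carrier G \<Longrightarrow> b \<in> carrier G \<Longrightarrow> v p (a \<otimes> b) = v p a + v p b"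
    and finite_support: "a \<in> carrier G \<Longrightarrow> finite {p \<in> P. 0 < v p a}"
    and dvd_if_le: "a \<in> carrier G \<Longrightarrow> b \<in> carrier G \<Longrightarrow> (\<And>p. p \<in> P \<Longrightarrow> v p a \<le> v p b)
      \<Longrightarrow> \<exists>c \<in> carrier G. b = a \<otimes> c"
    and isolated: "p \<in> P \<Longrightarrow> \<exists>e \<in> carrier G. 0 < v p e \<and> (\<forall>q \<in> P - {p}. v q e = 0)"
begin

lemma v_one: "p \<in> P \<Longrightarrow> v p \<one> = 0"
  using v_mult[of p \<one> \<one>] by simp

lemma v_pow: "p \<in> P \<Longrightarrow> a \<in> carrier G \<Longrightarrow> v p (a [^] (n :: nat)) = n * v p a"
  by (induction n) (simp_all add: v_one v_mult)

lemma root_closed: "root_closed G"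
  unfolding root_closed_def
proof (intro conjI ballI allI impI)
  show "comm_monoid_cancel G"
    by (rule is_comm_monoid_cancel)
  fix x and n :: nat
  assume "x \<in> carrier (quot_group G)" and n: "1 \<le> n"
    and pow: "x [^]\<^bsub>quot_group G\<^esub> n \<in> quot_emb G ` carrier G"
  then obtain a s where as: "a \<in> carrier G" "s \<in> carrier G" and x: "x = fraction G a s"
    unfolding quot_group_def by auto
  then obtain c where c: "c \<in> carrier G" "a [^] n = s [^] n \<otimes> c"
    using pow fraction_in_quot_emb_iff[of "a [^] n" "s [^] n"] by (auto simp: fraction_nat_pow)
  have "v p s \<le> v p a" if "p \<in> P" for p
  proof -
    have "n * v p a = n * v p s + v p c"
      using that as c by (simp add: v_mult flip: v_pow)
    then have "n * v p s \<le> n * v p a"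
      by simp
    then show ?thesis
      using n by simp
  qed
  then show "x \<in> quot_emb G ` carrier G"
    using dvd_if_le[of s a] as by (simp add: x fraction_in_quot_emb_iff)
qed

text \<open>The bounding element is a product of powers of the isolated elements. A prime that contains the
  product contains one of the factors, which is how the primes of the monoid are found; this is part of
  the statement because it depends on the shape of the product.\<close>

lemma supported_bound:
  assumes "finite F" "F \<subseteq> P"
  shows "\<exists>E \<in> carrier G. (\<forall>p \<in> F. n p \<le> v p E) \<and> (\<forall>q \<in> P - F. v q E = 0) \<and>
     (\<forall>\<qq>. prime_s_ideal G \<qq> \<and> E \<in> \<qq> \<longrightarrow>
        (\<exists>p \<in> F. \<exists>e \<in> \<qq>. 0 < v p e \<and> (\<forall>q \<in> P - {p}. v q e = 0)))"
  using assms
proof (induction F)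
  case empty
  show ?case
    using prime_s_ideal_one v_one by (intro bexI[of _ \<one>]) auto
next
  case (insert p F)
  then obtain E where E: "E \<in> carrier G" "\<forall>q \<in> F. n q \<le> v q E" "\<forall>q \<in> P - F. v q E = 0"
    and E_prime: "\<forall>\<qq>. prime_s_ideal G \<qq> \<and> E \<in> \<qq> \<longrightarrow>
        (\<exists>p \<in> F. \<exists>e \<in> \<qq>. 0 < v p e \<and> (\<forall>q \<in> P - {p}. v q e = 0))"
    by auto
  from insert have p: "p \<in> P"
    by simp
  then obtain e where e: "e \<in> carrier G" "0 < v p e" "\<forall>q \<in> P - {p}. v q e = 0"
    using isolated by blast
  let ?E = "E \<otimes> e [^] n p"
  have val: "v q ?E = v q E + n p * v q e" if "q \<in> P" for q
    using that E e by (simp add: v_mult v_pow)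
  have "n q \<le> v q ?E" if "q \<in> insert p F" for q
  proof (cases "q = p")
    case True
    have "n p \<le> n p * v p e"
      using e(2) by simp
    then show ?thesis
      using val[OF p] unfolding True by linarith
  next
    case False
    then have "n q \<le> v q E" "q \<in> P"
      using that E insert.prems by auto
    then show ?thesis
      using val[of q] by simp
  qed
  moreover have "v q ?E = 0" if "q \<in> P - insert p F" for q
    using that val[of q] E e by auto
  moreover have "\<exists>r \<in> insert p F. \<exists>e \<in> \<qq>. 0 < v r e \<and> (\<forall>q \<in> P - {r}. v q e = 0)"
    if prime: "prime_s_ideal G \<qq>" "?E \<in> \<qq>" for \<qq>
  proof (cases "E \<in> \<qq>")
    case True
    then show ?thesis
      using E_prime prime(1) by blast
  next
    case False
    then have "e [^] n p \<in> \<qq>"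
      using prime E(1) e(1) unfolding prime_s_ideal_def by (metis DiffD2 DiffI nat_pow_closed)
    then have "e \<in> \<qq>"
      using prime_s_ideal_pow prime(1) e(1) by blast
    then show ?thesis
      using e by blast
  qed
  ultimately show ?case
    using E e by (intro bexI[of _ ?E]) auto
qed

definition prime_at :: "'p \<Rightarrow> 'a set" where
  "prime_at p = {a \<in> carrier G. 0 < v p a}"

lemma prime_s_ideal_prime_at:
  assumes "p \<in> P"
  shows "prime_s_ideal G (prime_at p)"
proof -
  have "\<one> \<in> carrier G - prime_at p"
    using v_one[OF assms] unfolding prime_at_def by simp
  then have "prime_at p \<subset> carrier G"
    unfolding prime_at_def by blast
  then show ?thesis
    using assms unfolding prime_s_ideal_def s_ideal_def prime_at_def by (auto simp: v_mult)
qed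

lemma prime_at_nonempty: "p \<in> P \<Longrightarrow> prime_at p \<noteq> {}"
  using isolated unfolding prime_at_def by blast

text \<open>An element \<open>a\<close> of \<open>\<qq>\<close> divides a product of powers of isolated elements, so \<open>\<qq>\<close> contains an isolated
  element \<open>e\<close> over some \<open>p\<close>. Then \<open>e\<close> divides a power of each \<open>b\<close> with \<open>0 < v p b\<close>.\<close>

lemma prime_at_subset:
  assumes "prime_s_ideal G \<qq>" "\<qq> \<noteq> {}"
  shows "\<exists>p \<in> P. prime_at p \<subseteq> \<qq>"
proof -
  have sub: "\<qq> \<subseteq> carrier G" and ideal: "\<And>a h. a \<in> \<qq> \<Longrightarrow> h \<in> carrier G \<Longrightarrow> a \<otimes> h \<in> \<qq>"
    using assms(1) unfolding prime_s_ideal_def s_ideal_def by auto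
  obtain a where a: "a \<in> \<qq>" "a \<in> carrier G"
    using assms(2) sub by auto
  obtain E where E: "E \<in> carrier G" "\<forall>p \<in> {p \<in> P. 0 < v p a}. v p a \<le> v p E"
    and E_prime: "E \<in> \<qq> \<longrightarrow> (\<exists>p \<in> {p \<in> P. 0 < v p a}. \<exists>e \<in> \<qq>. 0 < v p e \<and> (\<forall>q \<in> P - {p}. v q e = 0))"
    using supported_bound[OF finite_support[OF a(2)], of "\<lambda>p. v p a"] assms(1) by blast
  have "v p a \<le> v p E" if "p \<in> P" for p
    using E(2) that by (cases "v p a = 0") auto
  then have "E \<in> \<qq>"
    using dvd_if_le[OF a(2) E(1)] ideal[OF a(1)] by auto
  then obtain p e where p: "p \<in> P" and e: "e \<in> \<qq>" "0 < v p e" "\<forall>q \<in> P - {p}. v q e = 0"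
    using E_prime by auto
  have e_G: "e \<in> carrier G"
    using e(1) sub by auto
  have "b \<in> \<qq>" if b: "b \<in> carrier G" "0 < v p b" for b
  proof -
    have "v q e \<le> v q (b [^] v p e)" if "q \<in> P" for q
      using that e b by (cases "q = p") (auto simp: v_pow)
    then have "b [^] v p e \<in> \<qq>"
      using dvd_if_le[OF e_G, of "b [^] v p e"] ideal[OF e(1)] b by auto
    then show ?thesis
      using prime_s_ideal_pow[OF assms(1)] b by blast
  qed
  then show ?thesis
    using p unfolding prime_at_def by blast
qed

lemma prime_at_inj:
  assumes "p \<in> P" "q \<in> P" "prime_at p \<subseteq> prime_at q"
  shows "p = q"
proof (rule ccontr)
  assume "p \<noteq> q"
  obtain e where "e \<in> carrier G" "0 < v p e" "\<forall>r \<in> P - {p}. v r e = 0"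
    using isolated[OF assms(1)] by blast
  then show False
    using assms \<open>p \<noteq> q\<close> unfolding prime_at_def by auto
qed

lemma min_primes_eq: "min_primes G = prime_at ` P"
proof
  show "min_primes G \<subseteq> prime_at ` P"
  proof
    fix \<pp> assume \<pp>: "\<pp> \<in> min_primes G"
    then obtain p where "p \<in> P" "prime_at p \<subseteq> \<pp>"
      using prime_at_subset[of \<pp>] unfolding min_primes_def by blast
    then show "\<pp> \<in> prime_at ` P"
      using \<pp> prime_s_ideal_prime_at[of p] prime_at_nonempty[of p] unfolding min_primes_def by blast
  qed
next
  show "prime_at ` P \<subseteq> min_primes G"
  proof
    fix \<pp> assume "\<pp> \<in> prime_at ` P"
    then obtain p where p: "p \<in> P" "\<pp> = prime_at p" by blast
    have "\<qq> = prime_at p" if \<qq>: "prime_s_ideal G \<qq>" "\<qq> \<noteq> {}" "\<qq> \<subseteq> prime_at p" for \<qq>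
    proof -
      obtain q where q: "q \<in> P" "prime_at q \<subseteq> \<qq>"
        using prime_at_subset[OF \<qq>(1,2)] by blast
      then have "q = p"
        using prime_at_inj[of q p] p \<qq>(3) by blast
      then show ?thesis
        using q \<qq>(3) by blast
    qed
    then show "\<pp> \<in> min_primes G"
      using p prime_s_ideal_prime_at[of p] prime_at_nonempty[of p] unfolding min_primes_def by blast
  qed
qed

text \<open>For the direction from right to left, the denominator has to be cleared of \<open>p\<close>: multiplying
  numerator and denominator by a \<open>t\<close> that is large at all other points of the support of \<open>s\<close> and
  trivial at \<open>p\<close> makes the numerator divisible by \<open>s\<close>, and \<open>t\<close> remains as denominator.\<close>

lemma fraction_in_localization_iff:
  assumes "p \<in> P" "a \<in> carrier G" "s \<in> carrier G"
  shows "fraction G a s \<in> carrier (localization G (prime_at p)) \<longleftrightarrow> v p s \<le> v p a"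
proof
  assume "fraction G a s \<in> carrier (localization G (prime_at p))"
  then obtain b t where bt: "b \<in> carrier G" "t \<in> carrier G" "v p t = 0"
    and "fraction G a s = fraction G b t"
    unfolding localization_def prime_at_def by auto
  then have "a \<otimes> t = b \<otimes> s"
    using assms by (simp add: fraction_eq_iff)
  then have "v p (a \<otimes> t) = v p (b \<otimes> s)"
    by simp
  then show "v p s \<le> v p a"
    using assms bt by (simp add: v_mult)
next
  assume le: "v p s \<le> v p a"
  let ?F = "{q \<in> P. 0 < v q s} - {p}"
  have "finite ?F" "?F \<subseteq> P"
    using finite_support[OF assms(3)] by auto
  then obtain t where t: "t \<in> carrier G" "\<forall>q \<in> ?F. v q s \<le> v q t" "\<forall>q \<in> P - ?F. v q t = 0"
    using supported_bound[of ?F "\<lambda>q. v q s"] by blast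
  have "v q s \<le> v q (a \<otimes> t)" if "q \<in> P" for q
  proof -
    have "v q s \<le> v q t \<or> q = p"
      using that t(2) by (cases "v q s = 0") auto
    then show ?thesis
      using le that assms t(1) by (auto simp: v_mult)
  qed
  then obtain c where c: "c \<in> carrier G" "a \<otimes> t = s \<otimes> c"
    using dvd_if_le[of s "a \<otimes> t"] assms t(1) by auto
  then have "fraction G a s = fraction G c t"
    using assms t by (simp add: fraction_eq_iff m_comm)
  moreover have "v p t = 0"
    using t(3) assms(1) by blast
  ultimately show "fraction G a s \<in> carrier (localization G (prime_at p))"
    using c t(1) unfolding localization_def prime_at_def by auto
qed

lemma weakly_Krull: "weakly_Krull G"
  unfolding weakly_Krull_def
proof (intro conjI ballI)
  show "comm_monoid_cancel G"
    by (rule is_comm_monoid_cancel)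
  show "quot_emb G ` carrier G =
      carrier (quot_group G) \<inter> (\<Inter>\<pp> \<in> min_primes G. carrier (localization G \<pp>))"
  proof (intro equalityI subsetI)
    fix x assume "x \<in> quot_emb G ` carrier G"
    then obtain a where a: "a \<in> carrier G" and x: "x = fraction G a \<one>"
      unfolding quot_emb_def by blast
    then have "x \<in> carrier (quot_group G)"
      unfolding quot_group_def by auto
    moreover have "x \<in> carrier (localization G (prime_at p))" if "p \<in> P" for p
      using that a by (simp add: x fraction_in_localization_iff v_one)
    ultimately show "x \<in> carrier (quot_group G) \<inter>
        (\<Inter>\<pp> \<in> min_primes G. carrier (localization G \<pp>))"
      unfolding min_primes_eq by blast
  next
    fix x assume x: "x \<in> carrier (quot_group G) \<inter>
        (\<Inter>\<pp> \<in> min_primes G. carrier (localization G \<pp>))"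
    then obtain a s where as: "a \<in> carrier G" "s \<in> carrier G" "x = fraction G a s"
      unfolding quot_group_def by auto
    have "v p s \<le> v p a" if "p \<in> P" for p
    proof -
      have "x \<in> carrier (localization G (prime_at p))"
        using x that unfolding min_primes_eq by blast
      then show ?thesis
        using that as fraction_in_localization_iff by simp
    qed
    then show "x \<in> quot_emb G ` carrier G"
      using dvd_if_le[of s a] as by (simp add: fraction_in_quot_emb_iff)
  qed
  fix a assume a: "a \<in> carrier G"
  have "{\<pp> \<in> min_primes G. a \<in> \<pp>} \<subseteq> prime_at ` {p \<in> P. 0 < v p a}"
    unfolding min_primes_eq prime_at_def by blast
  then show "finite {\<pp> \<in> min_primes G. a \<in> \<pp>}"
    using finite_support[OF a] finite_surj by blast
qed

text \<open>The values of \<open>v p\<close> on fractions form a nonzero subgroup of the integers, which is generated by its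
  least positive member. Division with remainder is carried out with products in the monoid, so that only
  differences of values of monoid elements occur.\<close>

lemma uniformizer:
  assumes "p \<in> P"
  shows "\<exists>a \<in> carrier G. \<exists>b \<in> carrier G. v p b < v p a \<and>
     (\<forall>x \<in> carrier G. \<forall>y \<in> carrier G. v p y \<le> v p x \<longrightarrow> (v p a - v p b) dvd (v p x - v p y))"
proof -
  define D where "D d \<longleftrightarrow> 0 < d \<and> (\<exists>a \<in> carrier G. \<exists>b \<in> carrier G. v p a = v p b + d)" for d
  obtain e where e: "e \<in> carrier G" "0 < v p e"
    using isolated[OF assms] by blast
  then have "D (v p e)"
    using v_one[OF assms] unfolding D_def by (metis add_0 one_closed)
  then have "D (LEAST d. D d)"
    by (rule LeastI)
  then obtain d where d: "d = (LEAST d. D d)" "D d" by blast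
  then obtain a b where ab: "a \<in> carrier G" "b \<in> carrier G" "v p a = v p b + d" "0 < d"
    unfolding D_def by blast
  have "d dvd v p x - v p y" if xy: "x \<in> carrier G" "y \<in> carrier G" "v p y \<le> v p x" for x y
  proof (rule ccontr)
    let ?m = "v p x - v p y"
    assume "\<not> d dvd ?m"
    then have pos: "0 < ?m mod d"
      by (simp add: dvd_eq_mod_eq_0)
    have "v p x + (?m div d) * v p b = (v p y + (?m div d) * v p a) + ?m mod d"
    proof -
      have "v p x = v p y + ((?m div d) * d + ?m mod d)"
        using xy(3) by simp
      then show ?thesis
        unfolding ab(3) by (simp only: distrib_left add_ac)
    qed
    then have "v p (x \<otimes> b [^] (?m div d)) = v p (y \<otimes> a [^] (?m div d)) + ?m mod d"
      using xy ab assms by (simp add: v_mult v_pow)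
    then have "D (?m mod d)"
      using pos xy ab unfolding D_def by blast
    then have "d \<le> ?m mod d"
      unfolding d(1) by (rule Least_le)
    then show False
      using ab(4) by (meson mod_less_divisor not_le)
  qed
  then show ?thesis
    using ab by (intro bexI[of _ a] bexI[of _ b]) auto
qed

lemma discrete_valuation_monoid_localization:
  assumes p: "p \<in> P"
  shows "discrete_valuation_monoid (localization G (prime_at p))"
proof -
  let ?L = "localization G (prime_at p)"
  obtain a b where ab: "a \<in> carrier G" "b \<in> carrier G" "v p b < v p a"
    and dvd: "\<forall>x \<in> carrier G. \<forall>y \<in> carrier G. v p y \<le> v p x \<longrightarrow> (v p a - v p b) dvd (v p x - v p y)"
    using uniformizer[OF p] by blast
  define d where "d = v p a - v p b"
  have d: "0 < d" "v p a = v p b + d"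
    using ab(3) unfolding d_def by auto
  have in_L: "\<exists>c s. c \<in> carrier G \<and> s \<in> carrier G \<and> v p s \<le> v p c \<and> x = fraction G c s"
    if "x \<in> carrier ?L" for x
  proof -
    from that obtain c s where cs: "c \<in> carrier G" "s \<in> carrier G" "x = fraction G c s"
      unfolding localization_def by auto
    then show ?thesis
      using that fraction_in_localization_iff[OF p cs(1,2)] by blast
  qed
  \<comment> \<open>the normalized value of a fraction, the same for all its representatives\<close>
  define w where "w x = (THE n. \<forall>c s. (c, s) \<in> x \<longrightarrow> v p c = v p s + n * d)" for x
  have w: "v p c = v p s + w (fraction G c s) * d"
    if cs: "c \<in> carrier G" "s \<in> carrier G" "v p s \<le> v p c" for c s
  proof -
    obtain n where n: "v p c - v p s = d * n"
      using dvd cs unfolding d_def[symmetric] by (blast elim: dvdE)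
    then have n: "v p c = v p s + n * d"
      using cs(3) by (simp add: mult.commute)
    have all: "v p c' = v p s' + n * d" if "(c', s') \<in> fraction G c s" for c' s'
    proof -
      have in_G: "c' \<in> carrier G" "s' \<in> carrier G" and "c \<otimes> s' = c' \<otimes> s"
        using that unfolding fraction_def by auto
      then have "v p (c \<otimes> s') = v p (c' \<otimes> s)"
        by simp
      then show ?thesis
        using in_G cs n p by (simp add: v_mult)
    qed
    have mem: "(c, s) \<in> fraction G c s"
      using cs unfolding fraction_def by simp
    have "w (fraction G c s) = n"
      unfolding w_def
    proof (rule the_equality)
      show "\<forall>c' s'. (c', s') \<in> fraction G c s \<longrightarrow> v p c' = v p s' + n * d"
        using all by blast
      fix m assume "\<forall>c' s'. (c', s') \<in> fraction G c s \<longrightarrow> v p c' = v p s' + m * d"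
      then have "v p c = v p s + m * d"
        using mem by blast
      then show "m = n"
        using n d(1) by simp
    qed
    then show ?thesis
      using n by simp
  qed
  have mult: "fraction G c s \<otimes>\<^bsub>?L\<^esub> fraction G c' s' = fraction G (c \<otimes> c') (s \<otimes> s')"
    if "c \<in> carrier G" "s \<in> carrier G" "c' \<in> carrier G" "s' \<in> carrier G" for c s c' s'
    using fraction_mult[OF that] unfolding localization_def by simp
  have "w (x \<otimes>\<^bsub>?L\<^esub> y) = w x + w y" if xy: "x \<in> carrier ?L" "y \<in> carrier ?L" for x y
  proof -
    obtain c s where cs: "c \<in> carrier G" "s \<in> carrier G" "v p s \<le> v p c" and x: "x = fraction G c s"
      using in_L[OF xy(1)] by blast
    obtain c' s' where cs': "c' \<in> carrier G" "s' \<in> carrier G" "v p s' \<le> v p c'"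
      and y: "y = fraction G c' s'"
      using in_L[OF xy(2)] by blast
    have "w (x \<otimes>\<^bsub>?L\<^esub> y) * d = (w x + w y) * d"
      using w[OF cs] w[OF cs'] w[of "c \<otimes> c'" "s \<otimes> s'"] cs cs' p mult[of c s c' s']
      by (simp add: x y v_mult add_mult_distrib)
    then show ?thesis
      using d(1) by simp
  qed
  moreover have "w ` carrier ?L = UNIV"
  proof -
    have "n \<in> w ` carrier ?L" for n
    proof -
      have le: "v p (b [^] n) \<le> v p (a [^] n)"
        using ab p by (simp add: v_pow)
      have "v p (b [^] n) + n * d = v p (b [^] n) + w (fraction G (a [^] n) (b [^] n)) * d"
        using w[OF _ _ le] ab p d(2) by (simp add: v_pow add_mult_distrib2)
      then have "w (fraction G (a [^] n) (b [^] n)) = n"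
        using d(1) by simp
      moreover have "fraction G (a [^] n) (b [^] n) \<in> carrier ?L"
        using le fraction_in_localization_iff[OF p] ab by simp
      ultimately show ?thesis
        by (metis imageI)
    qed
    then show ?thesis
      by blast
  qed
  moreover have "\<exists>z \<in> carrier ?L. y = x \<otimes>\<^bsub>?L\<^esub> z"
    if xy: "x \<in> carrier ?L" "y \<in> carrier ?L" "w x \<le> w y" for x y
  proof -
    obtain c s where cs: "c \<in> carrier G" "s \<in> carrier G" "v p s \<le> v p c" and x: "x = fraction G c s"
      using in_L[OF xy(1)] by blast
    obtain c' s' where cs': "c' \<in> carrier G" "s' \<in> carrier G" "v p s' \<le> v p c'"
      and y: "y = fraction G c' s'"
      using in_L[OF xy(2)] by blast
    have "w x * d \<le> w y * d"
      using xy(3) by simp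
    then have "v p (s' \<otimes> c) \<le> v p (c' \<otimes> s)"
      using w[OF cs] w[OF cs'] cs cs' p by (simp add: x y v_mult)
    then have "fraction G (c' \<otimes> s) (s' \<otimes> c) \<in> carrier ?L"
      using fraction_in_localization_iff[OF p] cs cs' by simp
    moreover have "y = x \<otimes>\<^bsub>?L\<^esub> fraction G (c' \<otimes> s) (s' \<otimes> c)"
      using cs cs' by (simp add: x y mult fraction_eq_iff m_ac)
    ultimately show ?thesis
      by blast
  qed
  ultimately show ?thesis
    using comm_monoid_cancel_localization[OF prime_s_ideal_prime_at[OF p]]
    unfolding discrete_valuation_monoid_iff by blast
qed

theorem Krull: "Krull G"
  using weakly_Krull discrete_valuation_monoid_localization
  unfolding Krull_def min_primes_eq by blast

end

section \<open>Copies of monoids and transfer homomorphisms\<close>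

lemma (in comm_monoid_cancel) mem_coset_Units_iff:
  assumes "b \<in> carrier G" "x \<in> b <# Units G"
  shows "x \<in> Units G \<longleftrightarrow> b \<in> Units G"
proof -
  have "\<exists>u \<in> Units G. x = b \<otimes> u"
    using assms(2) unfolding l_coset_def by simp
  then obtain u where u: "u \<in> Units G" and x: "x = b \<otimes> u" ..
  show ?thesis
  proof
    assume "x \<in> Units G"
    then have "u \<otimes> b \<in> Units G"
      using u assms(1) x by (simp add: m_comm Units_closed)
    then show "b \<in> Units G"
      using prod_unit_l[of u b] u assms(1) by (simp add: Units_closed)
  qed (use u x in simp)
qed

lemma transfer_hom_iso:
  assumes "comm_monoid_cancel H" "comm_monoid_cancel K" and f: "f \<in> iso H K" "f \<one>\<^bsub>H\<^esub> = \<one>\<^bsub>K\<^esub>"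
  shows "transfer_hom H K f"
proof -
  interpret H: comm_monoid_cancel H by fact
  interpret K: comm_monoid_cancel K by fact
  have hom: "f \<in> hom H K"
    and inj: "inj_on f (carrier H)" and surj: "f ` carrier H = carrier K"
    using f(1) unfolding iso_def bij_betw_def by auto
  have f_mult: "f (x \<otimes>\<^bsub>H\<^esub> y) = f x \<otimes>\<^bsub>K\<^esub> f y" if "x \<in> carrier H" "y \<in> carrier H" for x y
    using hom that by (simp add: hom_def)
  have f_closed: "f x \<in> carrier K" if "x \<in> carrier H" for x
    using surj that by blast
  have unit_iff: "f a \<in> Units K \<longleftrightarrow> a \<in> Units H" if a: "a \<in> carrier H" for a
  proof
    assume "f a \<in> Units K"
    then obtain y where y: "y \<in> carrier K" "f a \<otimes>\<^bsub>K\<^esub> y = \<one>\<^bsub>K\<^esub>"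
      using K.Units_r_inv K.Units_inv_closed by blast
    then obtain b where b: "b \<in> carrier H" "y = f b"
      using surj by blast
    then have "f (a \<otimes>\<^bsub>H\<^esub> b) = f \<one>\<^bsub>H\<^esub>"
      using y(2) a f(2) f_mult by simp
    then have "a \<otimes>\<^bsub>H\<^esub> b = \<one>\<^bsub>H\<^esub>"
      using inj_onD[OF inj] a b(1) by simp
    then show "a \<in> Units H"
      using a b(1) H.m_comm[of a b] unfolding Units_def by force
  next
    assume "a \<in> Units H"
    then have "f a \<otimes>\<^bsub>K\<^esub> f (inv\<^bsub>H\<^esub> a) = \<one>\<^bsub>K\<^esub>"
      using f(2) a by (simp flip: f_mult)
    moreover have "f a \<in> carrier K" "f (inv\<^bsub>H\<^esub> a) \<in> carrier K"
      using f_closed a H.Units_inv_closed[OF \<open>a \<in> Units H\<close>] by auto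
    ultimately show "f a \<in> Units K"
      using K.m_comm[of "f a" "f (inv\<^bsub>H\<^esub> a)"] unfolding Units_def by force
  qed
  have self_coset: "x \<in> x <#\<^bsub>K\<^esub> Units K" if "x \<in> carrier K" for x
    using that unfolding l_coset_def by force
  have split: "\<exists>v \<in> carrier H. \<exists>w \<in> carrier H. u = v \<otimes>\<^bsub>H\<^esub> w \<and>
      f v \<in> b <#\<^bsub>K\<^esub> Units K \<and> f w \<in> c <#\<^bsub>K\<^esub> Units K"
    if u: "u \<in> carrier H" "b \<in> carrier K" "c \<in> carrier K" "f u = b \<otimes>\<^bsub>K\<^esub> c" for u b c
  proof -
    obtain v w where vw: "v \<in> carrier H" "w \<in> carrier H" "b = f v" "c = f w"
      using u(2,3) surj by blast
    then have "f u = f (v \<otimes>\<^bsub>H\<^esub> w)"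
      using u(4) f_mult by simp
    then have "u = v \<otimes>\<^bsub>H\<^esub> w"
      using inj_onD[OF inj] u(1) vw(1,2) by simp
    then show ?thesis
      using vw self_coset u(2,3) by blast
  qed
  have "carrier K = f ` carrier H <#>\<^bsub>K\<^esub> Units K"
  proof
    show "carrier K \<subseteq> f ` carrier H <#>\<^bsub>K\<^esub> Units K"
      using self_coset unfolding surj set_mult_def l_coset_def by blast
    show "f ` carrier H <#>\<^bsub>K\<^esub> Units K \<subseteq> carrier K"
      unfolding surj set_mult_def by (auto simp: K.Units_closed)
  qed
  moreover have "{a \<in> carrier H. f a \<in> Units K} = Units H"
    using unit_iff H.Units_closed by blast
  ultimately show ?thesis
    using assms hom split unfolding transfer_hom_def by blast
qed

text \<open>The image of \<open>v\<close> factors as \<open>\<theta> u\<close> times some \<open>z\<close> because the target is Krull. Here \<open>z\<close> is not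
  a unit because \<open>z\<^sup>2 = \<theta> c\<close>, and the transfer property lifts the factorization.\<close>

lemma transfer_Krull_square_factor:
  assumes "transfer_Krull TYPE('b) H"
    and in_H: "u \<in> carrier H" "v \<in> carrier H" "c \<in> carrier H"
    and sq: "v \<otimes>\<^bsub>H\<^esub> v = c \<otimes>\<^bsub>H\<^esub> (u \<otimes>\<^bsub>H\<^esub> u)"
    and nonunits: "u \<notin> Units H" "c \<notin> Units H"
  shows "\<exists>a \<in> carrier H - Units H. \<exists>b \<in> carrier H - Units H. v = a \<otimes>\<^bsub>H\<^esub> b"
proof -
  obtain K :: "'b monoid" and \<theta> where "Krull K" and trans: "transfer_hom H K \<theta>"
    using assms(1) unfolding transfer_Krull_def by blast
  interpret H: comm_monoid_cancel H
    using trans unfolding transfer_hom_def by simp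
  interpret K: comm_monoid_cancel K
    using trans unfolding transfer_hom_def by simp
  have hom: "\<theta> \<in> hom H K" and units: "{a \<in> carrier H. \<theta> a \<in> Units K} = Units H"
    using trans unfolding transfer_hom_def by simp_all
  have \<theta>_closed: "\<theta> x \<in> carrier K" if "x \<in> carrier H" for x
    using hom that unfolding hom_def by blast
  have \<theta>_mult: "\<theta> (x \<otimes>\<^bsub>H\<^esub> y) = \<theta> x \<otimes>\<^bsub>K\<^esub> \<theta> y" if "x \<in> carrier H" "y \<in> carrier H" for x y
    using hom that unfolding hom_def by simp
  have unit_iff: "\<theta> x \<in> Units K \<longleftrightarrow> x \<in> Units H" if "x \<in> carrier H" for x
    using units that by blast
  have sq': "\<theta> v \<otimes>\<^bsub>K\<^esub> \<theta> v = \<theta> c \<otimes>\<^bsub>K\<^esub> (\<theta> u \<otimes>\<^bsub>K\<^esub> \<theta> u)"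
    using arg_cong[OF sq, of \<theta>] in_H by (simp add: \<theta>_mult)
  then obtain z where z: "z \<in> carrier K" "\<theta> v = \<theta> u \<otimes>\<^bsub>K\<^esub> z"
    using Krull_dvd_of_square_dvd[OF \<open>Krull K\<close>, of "\<theta> u" "\<theta> v" "\<theta> c"] \<theta>_closed in_H by blast
  have "(\<theta> u \<otimes>\<^bsub>K\<^esub> \<theta> u) \<otimes>\<^bsub>K\<^esub> (z \<otimes>\<^bsub>K\<^esub> z) = (\<theta> u \<otimes>\<^bsub>K\<^esub> \<theta> u) \<otimes>\<^bsub>K\<^esub> \<theta> c"
    using sq' z(1) in_H \<theta>_closed unfolding z(2) by (simp add: K.m_ac)
  then have "z \<otimes>\<^bsub>K\<^esub> z = \<theta> c"
    using K.l_cancel[of "\<theta> u \<otimes>\<^bsub>K\<^esub> \<theta> u" "z \<otimes>\<^bsub>K\<^esub> z" "\<theta> c"] z(1) in_H \<theta>_closed by simp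
  then have z_nonunit: "z \<notin> Units K"
    using nonunits(2) unit_iff[OF in_H(3)] K.Units_m_closed[of z z] by auto
  obtain a b where ab: "a \<in> carrier H" "b \<in> carrier H" "v = a \<otimes>\<^bsub>H\<^esub> b"
    and cosets: "\<theta> a \<in> \<theta> u <#\<^bsub>K\<^esub> Units K" "\<theta> b \<in> z <#\<^bsub>K\<^esub> Units K"
    using trans in_H z \<theta>_closed[OF in_H(1)] unfolding transfer_hom_def by blast
  have "a \<notin> Units H"
    using K.mem_coset_Units_iff[OF \<theta>_closed[OF in_H(1)] cosets(1)]
      unit_iff[OF ab(1)] unit_iff[OF in_H(1)] nonunits(1) by simp
  moreover have "b \<notin> Units H"
    using K.mem_coset_Units_iff[OF z(1) cosets(2)] unit_iff[OF ab(2)] z_nonunit by simp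
  ultimately show ?thesis
    using ab by blast
qed

definition copy_monoid :: "('a \<Rightarrow> 'b) \<Rightarrow> ('a, 'm) monoid_scheme \<Rightarrow> 'b monoid" where
  "copy_monoid f H = \<lparr>carrier = f ` carrier H,
     monoid.mult = (\<lambda>x y. f (inv_into (carrier H) f x \<otimes>\<^bsub>H\<^esub> inv_into (carrier H) f y)),
     one = f \<one>\<^bsub>H\<^esub>\<rparr>"

lemma (in comm_monoid_cancel) comm_monoid_cancel_copy:
  assumes "inj_on f (carrier G)"
  shows "comm_monoid_cancel (copy_monoid f G)"
proof (rule comm_monoid_cancelI)
  show "comm_monoid (copy_monoid f G)"
    by (rule comm_monoidI) (auto simp: copy_monoid_def assms m_assoc, simp_all add: m_comm)
  fix x y z
  assume eq: "x \<otimes>\<^bsub>copy_monoid f G\<^esub> z = y \<otimes>\<^bsub>copy_monoid f G\<^esub> z"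
    and "x \<in> carrier (copy_monoid f G)" "y \<in> carrier (copy_monoid f G)"
      "z \<in> carrier (copy_monoid f G)"
  then obtain a b c where abc: "a \<in> carrier G" "b \<in> carrier G" "c \<in> carrier G"
    and xyz: "x = f a" "y = f b" "z = f c"
    unfolding copy_monoid_def by auto
  then have "f (a \<otimes> c) = f (b \<otimes> c)"
    using eq assms by (simp add: copy_monoid_def)
  then have "a \<otimes> c = b \<otimes> c"
    using inj_onD[OF assms] abc by simp
  then show "x = y"
    using r_cancel abc xyz by blast
qed

lemma iso_copy_monoid:
  assumes "inj_on f (carrier H)"
  shows "f \<in> iso H (copy_monoid f H)"
  using assms unfolding iso_def hom_def bij_betw_def copy_monoid_def by auto

lemma (in torsion_valuations) torsion_valuations_copy:
  assumes inj: "inj_on f (carrier G)"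
  shows "torsion_valuations (copy_monoid f G) P (\<lambda>p x. v p (inv_into (carrier G) f x))"
proof (intro torsion_valuations.intro torsion_valuations_axioms.intro)
  let ?K = "copy_monoid f G" and ?v = "\<lambda>p x. v p (inv_into (carrier G) f x)"
  have carr: "carrier ?K = f ` carrier G"
    by (simp add: copy_monoid_def)
  have mult: "f a \<otimes>\<^bsub>?K\<^esub> f b = f (a \<otimes> b)" if "a \<in> carrier G" "b \<in> carrier G" for a b
    using inj that by (simp add: copy_monoid_def)
  have inv: "inv_into (carrier G) f (f a) = a" if "a \<in> carrier G" for a
    using inj that by simp
  show "comm_monoid_cancel ?K"
    by (rule comm_monoid_cancel_copy[OF inj])
  show "?v p (x \<otimes>\<^bsub>?K\<^esub> y) = ?v p x + ?v p y"
    if "p \<in> P" "x \<in> carrier ?K" "y \<in> carrier ?K" for p x y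
    using that by (auto simp: carr mult inv v_mult)
  show "finite {p \<in> P. 0 < ?v p x}" if "x \<in> carrier ?K" for x
    using that finite_support by (auto simp: carr inv)
  show "\<exists>z \<in> carrier ?K. y = x \<otimes>\<^bsub>?K\<^esub> z"
    if xy: "x \<in> carrier ?K" "y \<in> carrier ?K" "\<And>p. p \<in> P \<Longrightarrow> ?v p x \<le> ?v p y" for x y
  proof -
    obtain a b where ab: "a \<in> carrier G" "b \<in> carrier G" "x = f a" "y = f b"
      using xy(1,2) unfolding carr by blast
    then have "v p a \<le> v p b" if "p \<in> P" for p
      using xy(3)[OF that] by (simp add: inv)
    then obtain c where "c \<in> carrier G" "b = a \<otimes> c"
      using dvd_if_le[OF ab(1,2)] by blast
    then show ?thesis
      using ab mult[of a c] unfolding carr by (intro bexI[of _ "f c"]) auto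
  qed
  show "\<exists>x \<in> carrier ?K. 0 < ?v p x \<and> (\<forall>q \<in> P - {p}. ?v q x = 0)" if "p \<in> P" for p
    using isolated[OF that] unfolding carr by (auto simp: inv)
qed

text \<open>A countable carrier embeds into the naturals and hence into any infinite type; the monoid is
  isomorphic to its image there, and isomorphisms are transfer homomorphisms.\<close>

lemma (in torsion_valuations) transfer_Krull:
  assumes "countable (carrier G)"
  shows "transfer_Krull TYPE('c :: infinite) G"
proof -
  obtain h :: "nat \<Rightarrow> 'c" where h: "inj h"
    using infinite_countable_subset[OF infinite_UNIV] by blast
  let ?f = "h \<circ> to_nat_on (carrier G)"
  have inj: "inj_on ?f (carrier G)"
    using assms h by (intro comp_inj_on) (auto intro: inj_on_subset)
  interpret K: torsion_valuations "copy_monoid ?f G" P "\<lambda>p x. v p (inv_into (carrier G) ?f x)"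
    by (rule torsion_valuations_copy[OF inj])
  have "transfer_hom G (copy_monoid ?f G) ?f"
    using is_comm_monoid_cancel K.is_comm_monoid_cancel iso_copy_monoid[OF inj]
    by (rule transfer_hom_iso) (simp add: copy_monoid_def)
  then show ?thesis
    using K.Krull unfolding transfer_Krull_def by blast
qed

section \<open>Weighted zero-sum sequences\<close>

locale weighted_zero_sums = comm_group G for G (structure) +
  fixes \<Gamma> :: "('a \<Rightarrow> 'a) set"
  assumes weights_auto: "\<Gamma> \<subseteq> auto G"
    and id_weight: "(\<lambda>g \<in> carrier G. g) \<in> \<Gamma>"
    and inv_weight: "(\<lambda>g \<in> carrier G. inv g) \<in> \<Gamma>"
begin

abbreviation B :: "'a multiset monoid" where
  "B \<equiv> B_Gamma G \<Gamma>"

text \<open>A weighted sequence is kept as one list of weight-element pairs, so that sequences are concatenated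
  without shifting the indices of the weights.\<close>

definition weighted_prod :: "(('a \<Rightarrow> 'a) \<times> 'a) list \<Rightarrow> 'a" where
  "weighted_prod ps = foldr (\<lambda>(\<gamma>, g) z. \<gamma> g \<otimes> z) ps \<one>"

lemma weighted_prod_simps [simp]:
  "weighted_prod [] = \<one>"
  "weighted_prod ((\<gamma>, g) # ps) = \<gamma> g \<otimes> weighted_prod ps"
  by (simp_all add: weighted_prod_def)

lemma weight_hom: "\<gamma> \<in> \<Gamma> \<Longrightarrow> \<gamma> \<in> hom G G"
  using weights_auto unfolding auto_def by auto

lemma weight_closed: "\<gamma> \<in> \<Gamma> \<Longrightarrow> g \<in> carrier G \<Longrightarrow> \<gamma> g \<in> carrier G"
  using weight_hom unfolding hom_def by auto

lemma weight_eq_one_iff: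
  assumes "\<gamma> \<in> \<Gamma>" "g \<in> carrier G"
  shows "\<gamma> g = \<one> \<longleftrightarrow> g = \<one>"
proof -
  have "\<gamma> \<one> = \<one>"
    using hom_one[OF weight_hom[OF assms(1)]] is_group by simp
  moreover have "inj_on \<gamma> (carrier G)"
    using weights_auto assms(1) unfolding auto_def Bij_def bij_betw_def by auto
  ultimately show ?thesis
    using assms(2) inj_onD[of \<gamma> "carrier G" g \<one>] by auto
qed

lemma weighted_prod_closed: "set ps \<subseteq> \<Gamma> \<times> carrier G \<Longrightarrow> weighted_prod ps \<in> carrier G"
  by (induction ps) (auto simp: weight_closed)

lemma weighted_prod_append:
  assumes "set ps \<subseteq> \<Gamma> \<times> carrier G" "set qs \<subseteq> \<Gamma> \<times> carrier G"
  shows "weighted_prod (ps @ qs) = weighted_prod ps \<otimes> weighted_prod qs"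
  using assms by (induction ps) (auto simp: weight_closed weighted_prod_closed m_assoc)

lemma weighted_prod_eq_finprod:
  assumes "set ps \<subseteq> \<Gamma> \<times> carrier G"
  shows "weighted_prod ps = (\<Otimes>i \<in> {..<length ps}. fst (ps ! i) (snd (ps ! i)))"
  using assms
proof (induction ps)
  case Nil
  show ?case by simp
next
  case (Cons q ps)
  let ?f = "\<lambda>i. fst ((q # ps) ! i) (snd ((q # ps) ! i))"
  have f: "?f i \<in> carrier G" if "i < Suc (length ps)" for i
  proof -
    have "(q # ps) ! i \<in> \<Gamma> \<times> carrier G"
      using Cons.prems nth_mem[of i "q # ps"] that by auto
    then show ?thesis
      using weight_closed by (auto simp: mem_Times_iff)
  qed
  have "finprod G ?f {..<length (q # ps)} = finprod G ?f (insert 0 (Suc ` {..<length ps}))"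
    by (simp add: lessThan_Suc_eq_insert_0)
  also have "\<dots> = ?f 0 \<otimes> finprod G ?f (Suc ` {..<length ps})"
    by (rule finprod_insert) (use f f[of 0] in auto)
  also have "finprod G ?f (Suc ` {..<length ps}) = finprod G (\<lambda>i. ?f (Suc i)) {..<length ps}"
    by (rule finprod_reindex) (use f in auto)
  finally show ?case
    using Cons by (cases q) auto
qed

lemma carrier_B: "carrier B = {mset gs | gs. set gs \<subseteq> carrier G \<and>
    (\<exists>\<gamma> \<in> {..<length gs} \<rightarrow> \<Gamma>. (\<Otimes>i \<in> {..<length gs}. \<gamma> i (gs ! i)) = \<one>)}"
  by (simp add: B_Gamma_def)

lemma mem_B_iff:
  "S \<in> carrier B \<longleftrightarrow>
     (\<exists>ps. set ps \<subseteq> \<Gamma> \<times> carrier G \<and> S = mset (map snd ps) \<and> weighted_prod ps = \<one>)"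
proof
  assume "S \<in> carrier B"
  then obtain gs \<gamma> where gs: "set gs \<subseteq> carrier G" "S = mset gs"
    and \<gamma>: "\<gamma> \<in> {..<length gs} \<rightarrow> \<Gamma>" "(\<Otimes>i \<in> {..<length gs}. \<gamma> i (gs ! i)) = \<one>"
    unfolding carrier_B by auto
  define ps where "ps = map (\<lambda>i. (\<gamma> i, gs ! i)) [0..<length gs]"
  have ps: "set ps \<subseteq> \<Gamma> \<times> carrier G"
    using gs(1) \<gamma>(1) unfolding ps_def by (auto simp: subset_iff)
  have "map snd ps = gs"
    unfolding ps_def by (simp add: comp_def map_nth)
  moreover have "(\<Otimes>i \<in> {..<length ps}. fst (ps ! i) (snd (ps ! i)))
      = (\<Otimes>i \<in> {..<length gs}. \<gamma> i (gs ! i))"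
  proof (rule finprod_cong')
    show "{..<length ps} = {..<length gs}"
      unfolding ps_def by simp
    show "(\<lambda>i. \<gamma> i (gs ! i)) \<in> {..<length gs} \<rightarrow> carrier G"
      using gs(1) \<gamma>(1) weight_closed by (auto simp: subset_iff Pi_iff)
    show "fst (ps ! i) (snd (ps ! i)) = \<gamma> i (gs ! i)" if "i \<in> {..<length gs}" for i
      using that unfolding ps_def by simp
  qed
  ultimately show "\<exists>ps. set ps \<subseteq> \<Gamma> \<times> carrier G \<and> S = mset (map snd ps) \<and> weighted_prod ps = \<one>"
    using ps gs(2) \<gamma>(2) weighted_prod_eq_finprod[OF ps] by (intro exI[of _ ps]) simp
next
  assume "\<exists>ps. set ps \<subseteq> \<Gamma> \<times> carrier G \<and> S = mset (map snd ps) \<and> weighted_prod ps = \<one>"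
  then obtain ps where ps: "set ps \<subseteq> \<Gamma> \<times> carrier G" "S = mset (map snd ps)" "weighted_prod ps = \<one>"
    by blast
  have in_prod: "ps ! i \<in> \<Gamma> \<times> carrier G" if "i < length ps" for i
    using ps(1) that nth_mem by blast
  have "(\<Otimes>i \<in> {..<length (map snd ps)}. fst (ps ! i) (map snd ps ! i))
      = (\<Otimes>i \<in> {..<length ps}. fst (ps ! i) (snd (ps ! i)))"
  proof (rule finprod_cong')
    show "(\<lambda>i. fst (ps ! i) (snd (ps ! i))) \<in> {..<length ps} \<rightarrow> carrier G"
      using in_prod weight_closed by (auto simp: mem_Times_iff)
  qed auto
  then have "(\<Otimes>i \<in> {..<length (map snd ps)}. fst (ps ! i) (map snd ps ! i)) = \<one>"
    using ps(3) weighted_prod_eq_finprod[OF ps(1)] by simp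
  moreover have "(\<lambda>i. fst (ps ! i)) \<in> {..<length (map snd ps)} \<rightarrow> \<Gamma>"
    using in_prod by (auto simp: mem_Times_iff)
  moreover have "set (map snd ps) \<subseteq> carrier G"
    using ps(1) by auto
  ultimately show "S \<in> carrier B"
    unfolding carrier_B ps(2)
    by (intro CollectI exI[of _ "map snd ps"] conjI bexI[of _ "\<lambda>i. fst (ps ! i)"] refl)
qed

lemma mult_B [simp]: "S \<otimes>\<^bsub>B\<^esub> T = S + T"
  by (simp add: B_Gamma_def free_abelian_monoid_def)

lemma one_B [simp]: "\<one>\<^bsub>B\<^esub> = {#}"
  by (simp add: B_Gamma_def free_abelian_monoid_def)

lemma set_mset_B: "S \<in> carrier B \<Longrightarrow> set_mset S \<subseteq> carrier G"
  unfolding carrier_B by auto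

lemma B_I:
  assumes "set ps \<subseteq> \<Gamma> \<times> carrier G" "weighted_prod ps = \<one>" "S = mset (map snd ps)"
  shows "S \<in> carrier B"
  using assms unfolding mem_B_iff by blast

lemma add_B:
  assumes "S \<in> carrier B" "T \<in> carrier B"
  shows "S + T \<in> carrier B"
proof -
  obtain ps qs where "set ps \<subseteq> \<Gamma> \<times> carrier G" "S = mset (map snd ps)" "weighted_prod ps = \<one>"
    "set qs \<subseteq> \<Gamma> \<times> carrier G" "T = mset (map snd qs)" "weighted_prod qs = \<one>"
    using assms unfolding mem_B_iff by blast
  then show ?thesis
    by (intro B_I[of "ps @ qs"]) (auto simp: weighted_prod_append)
qed

lemma empty_B: "{#} \<in> carrier B"
  by (rule B_I[of "[]"]) auto

sublocale B: comm_monoid_cancel B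
proof (rule comm_monoid_cancelI)
  show "comm_monoid B"
    by (rule comm_monoidI) (auto simp: add_B empty_B)
qed auto

lemma Units_B: "Units B = {{#}}"
  using empty_B unfolding Units_def by auto

lemma singleton_B: "{#g#} \<in> carrier B \<Longrightarrow> g = \<one>"
proof -
  assume "{#g#} \<in> carrier B"
  then obtain ps where ps: "set ps \<subseteq> \<Gamma> \<times> carrier G" "{#g#} = mset (map snd ps)" "weighted_prod ps = \<one>"
    unfolding mem_B_iff by (elim exE conjE) (rule that)
  have "length ps = 1"
    using arg_cong[OF ps(2), of size] by simp
  then obtain q where "ps = [q]"
    by (auto simp: length_Suc_conv)
  then obtain \<gamma> where "ps = [(\<gamma>, g)]"
    using ps(2) by (cases q) simp
  then have "\<gamma> \<in> \<Gamma>" "g \<in> carrier G" "\<gamma> g = \<one>"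
    using ps(1,3) weight_closed by auto
  then show "g = \<one>"
    by (simp add: weight_eq_one_iff)
qed

lemma double_B:
  assumes "g \<in> carrier G"
  shows "{#g, g#} \<in> carrier B"
  using assms id_weight inv_weight
  by (intro B_I[of "[(\<lambda>g \<in> carrier G. g, g), (\<lambda>g \<in> carrier G. inv g, g)]"]) auto

text \<open>Each element cancels against its second copy with weights \<open>id\<close> and \<open>-id\<close>.\<close>

lemma add_self_B: "set_mset S \<subseteq> carrier G \<Longrightarrow> S + S \<in> carrier B"
proof (induction S)
  case empty
  show ?case
    using empty_B by simp
next
  case (add g S)
  then have "{#g, g#} + (S + S) \<in> carrier B"
    using add_B[OF double_B, of g "S + S"] by auto
  then show ?case
    by simp
qed

subsection \<open>The obstruction\<close>

text \<open>The denominators \<open>{#y, y#}\<close> and \<open>T\<close> both turn \<open>x\<close> into a fraction over \<open>B\<close>, and \<open>y\<close> occurs only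
  in the first. If \<open>2g \<noteq> 0\<close>, then \<open>g \<noteq> -g\<close>, so \<open>T\<close> may consist of two copies of \<open>-g\<close>. In the second case,
  \<open>\<gamma>(y) + y = x\<close> has \<open>y = g\<close> as a solution, possibly the only one. But \<open>g\<close> is the sum of \<open>h = \<gamma>(g)\<close>
  and \<open>g + h\<close>, both different from \<open>g\<close>, and \<open>\<gamma>\<close> is additive; hence \<open>T\<close> consists of two copies of each,
  one of which is given the weight \<open>\<gamma>\<close>.\<close>

lemma obstruction:
  assumes "\<not> (elementary_2_group G \<and> \<Gamma> = {\<lambda>g \<in> carrier G. g, \<lambda>g \<in> carrier G. inv g})"
  obtains x y T where "x \<in> carrier G" "y \<in> carrier G" "x \<noteq> \<one>" "y \<noteq> \<one>"
    "{#x, y, y#} \<in> carrier B" "T \<in> carrier B" "y \<notin># T" "{#x#} + T \<in> carrier B"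
proof (cases "elementary_2_group G")
  case False
  let ?id = "\<lambda>g \<in> carrier G. g" and ?inv = "\<lambda>g \<in> carrier G. inv g"
  from False obtain g where g: "g \<in> carrier G" "g \<otimes> g \<noteq> \<one>"
    using comm_group_axioms unfolding elementary_2_group_def by auto
  have inv_ne: "g \<noteq> inv g"
    using g r_inv[OF g(1)] by metis
  have cancel: "g \<otimes> g \<otimes> (inv g \<otimes> inv g) = \<one>"
    using g(1) by (simp flip: inv_mult)
  show ?thesis
  proof (rule that[of "g \<otimes> g" g "{#inv g, inv g#}"])
    show "g \<otimes> g \<in> carrier G" "g \<in> carrier G" "g \<otimes> g \<noteq> \<one>" "g \<noteq> \<one>"
      using g by auto
    show "{#g \<otimes> g, g, g#} \<in> carrier B"
      using g id_weight inv_weight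
      by (intro B_I[of "[(?id, g \<otimes> g), (?inv, g), (?inv, g)]"]) (simp_all add: cancel)
    show "{#inv g, inv g#} \<in> carrier B"
      using g by (simp add: double_B)
    show "g \<notin># {#inv g, inv g#}"
      using inv_ne by simp
    show "{#g \<otimes> g#} + {#inv g, inv g#} \<in> carrier B"
      using g id_weight
      by (intro B_I[of "[(?id, g \<otimes> g), (?id, inv g), (?id, inv g)]"]) (simp_all add: cancel)
  qed
next
  case True
  let ?id = "\<lambda>g \<in> carrier G. g"
  have two: "g \<otimes> g = \<one>" if "g \<in> carrier G" for g
    using True that unfolding elementary_2_group_def by blast
  then have inv_eq: "inv g = g" if "g \<in> carrier G" for g
    using that inv_equality by blast
  then have "(\<lambda>g \<in> carrier G. inv g) = ?id"
    by (rule restrict_ext)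
  then obtain \<gamma> where \<gamma>: "\<gamma> \<in> \<Gamma>" "\<gamma> \<noteq> ?id"
    using assms True id_weight by auto
  have "\<gamma> \<in> extensional (carrier G)"
    using \<gamma>(1) weights_auto unfolding auto_def Bij_def by auto
  then obtain g where g: "g \<in> carrier G" "\<gamma> g \<noteq> g"
    using \<gamma>(2) extensionalityI[of \<gamma> "carrier G" ?id] by auto
  define h where "h = \<gamma> g"
  have h: "h \<in> carrier G" "h \<noteq> g"
    using g weight_closed[OF \<gamma>(1)] unfolding h_def by auto
  define k where "k = \<gamma> h"
  have k: "k \<in> carrier G"
    using h weight_closed[OF \<gamma>(1)] unfolding k_def by auto
  have cancel: "a \<otimes> (a \<otimes> b) = b" if "a \<in> carrier G" "b \<in> carrier G" for a b
    using that two[of a] by (simp flip: m_assoc)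
  have \<gamma>gh: "\<gamma> (g \<otimes> h) = h \<otimes> k"
    using weight_hom[OF \<gamma>(1)] g h unfolding hom_def h_def k_def by auto
  have ne: "g \<noteq> \<one>" "h \<noteq> \<one>"
    using g h weight_eq_one_iff[OF \<gamma>(1) g(1)] unfolding h_def by auto
  show ?thesis
  proof (rule that[of "g \<otimes> h" g "{#h, h, g \<otimes> h, g \<otimes> h#}"])
    show "g \<otimes> h \<in> carrier G" "g \<in> carrier G" "g \<noteq> \<one>"
      using g h ne by auto
    show "g \<otimes> h \<noteq> \<one>"
      using cancel[of g h] g h by auto
    show "{#g \<otimes> h, g, g#} \<in> carrier B"
      using g h \<gamma>(1) id_weight
      by (intro B_I[of "[(?id, g \<otimes> h), (?id, g), (\<gamma>, g)]"])
        (auto simp: m_ac cancel two simp flip: h_def)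
    have "{#h, h#} + {#g \<otimes> h, g \<otimes> h#} \<in> carrier B"
      using g h by (intro add_B double_B) auto
    then show "{#h, h, g \<otimes> h, g \<otimes> h#} \<in> carrier B"
      by (simp add: add_mset_commute)
    have "g \<otimes> h \<noteq> g"
      using l_cancel[of g h \<one>] g(1) h(1) ne(2) r_one[OF g(1)] one_closed by metis
    then show "g \<notin># {#h, h, g \<otimes> h, g \<otimes> h#}"
      using not_sym[OF h(2)] by simp
    \<comment> \<open>with \<open>k = \<gamma>(h)\<close>, additively \<open>(g + h) + h + k + (g + h) + (h + k)\<close>, in which every term occurs
      an even number of times\<close>
    show "{#g \<otimes> h#} + {#h, h, g \<otimes> h, g \<otimes> h#} \<in> carrier B"
      using g h k \<gamma>(1) id_weight
      by (intro B_I[of "[(?id, g \<otimes> h), (?id, h), (\<gamma>, h), (?id, g \<otimes> h), (\<gamma>, g \<otimes> h)]"])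
        (auto simp: \<gamma>gh m_ac cancel two simp flip: k_def)
  qed
qed

text \<open>The element \<open>x\<close> is a fraction over \<open>B\<close> whose square \<open>{#x, x#}\<close> belongs to \<open>B\<close>.\<close>

lemma not_root_closed:
  assumes x: "x \<in> carrier G" "x \<noteq> \<one>" and T: "T \<in> carrier B" "{#x#} + T \<in> carrier B"
  shows "\<not> root_closed B"
proof
  assume root: "root_closed B"
  let ?x = "fraction B ({#x#} + T) T"
  have "({#x#} + T) [^]\<^bsub>B\<^esub> (2::nat) = T [^]\<^bsub>B\<^esub> (2::nat) \<otimes>\<^bsub>B\<^esub> {#x, x#}"
    by (simp add: numeral_2_eq_2 nat_pow_def)
  then have "?x [^]\<^bsub>quot_group B\<^esub> (2::nat) \<in> quot_emb B ` carrier B"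
    using B.fraction_in_quot_emb_iff[of "({#x#} + T) [^]\<^bsub>B\<^esub> (2::nat)" "T [^]\<^bsub>B\<^esub> (2::nat)"]
      T double_B[OF x(1)] B.nat_pow_closed B.fraction_nat_pow[OF T(2,1), of 2] by metis
  moreover have "?x \<in> carrier (quot_group B)"
    using T unfolding quot_group_def by auto
  moreover have "(1::nat) \<le> 2"
    by simp
  ultimately have "?x \<in> quot_emb B ` carrier B"
    using root unfolding root_closed_def by blast
  then show False
    using T x singleton_B by (auto simp: B.fraction_in_quot_emb_iff)
qed

text \<open>The set \<open>{S \<in> B. y \<in># S}\<close> is a prime. It is contained in \<open>\<pp>\<close>, because the square of each member is
  \<open>{#y, y#}\<close> times an element of the form \<open>R + R\<close>. Minimality of \<open>\<pp>\<close> gives equality.\<close>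

lemma min_prime_double:
  assumes \<pp>: "\<pp> \<in> min_primes B" and y: "y \<in> carrier G" "{#y, y#} \<in> \<pp>" and "T \<in> \<pp>"
  shows "y \<in># T"
proof -
  have prime: "prime_s_ideal B \<pp>"
    using \<pp> unfolding min_primes_def by blast
  let ?\<qq> = "{S \<in> carrier B. y \<in># S}"
  have "{#} \<in> carrier B - ?\<qq>"
    using empty_B by simp
  then have "?\<qq> \<subset> carrier B"
    by blast
  then have "prime_s_ideal B ?\<qq>"
    using add_B unfolding prime_s_ideal_def s_ideal_def by auto
  moreover have "?\<qq> \<noteq> {}"
    using double_B[OF y(1)] by auto
  moreover have "?\<qq> \<subseteq> \<pp>"
  proof
    fix S assume "S \<in> ?\<qq>"
    then have "S \<in> carrier B" "y \<in># S"
      by simp_all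
    then obtain R where S: "S \<in> carrier B" "S = add_mset y R"
      using multi_member_split[of y S] by metis
    have "R + R \<in> carrier B"
      using set_mset_B[OF S(1)] S(2) by (intro add_self_B) simp
    then have "{#y, y#} \<otimes>\<^bsub>B\<^esub> (R + R) \<in> \<pp>"
      using prime y(2) unfolding prime_s_ideal_def s_ideal_def by blast
    then have "S \<otimes>\<^bsub>B\<^esub> S \<in> \<pp>"
      using S(2) by simp
    then show "S \<in> \<pp>"
      using prime S(1) unfolding prime_s_ideal_def by blast
  qed
  ultimately have "?\<qq> = \<pp>"
    using \<pp> unfolding min_primes_def by blast
  then show ?thesis
    using \<open>T \<in> \<pp>\<close> by blast
qed

text \<open>Every minimal prime misses \<open>{#y, y#}\<close> or \<open>T\<close>, so \<open>x\<close> lies in every localization.\<close>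

lemma not_weakly_Krull:
  assumes "x \<in> carrier G" "y \<in> carrier G" "x \<noteq> \<one>"
    and xyy: "{#x, y, y#} \<in> carrier B" and T: "T \<in> carrier B" "y \<notin># T" "{#x#} + T \<in> carrier B"
  shows "\<not> weakly_Krull B"
proof
  assume wK: "weakly_Krull B"
  let ?x = "fraction B {#x, y, y#} {#y, y#}"
  have yy: "{#y, y#} \<in> carrier B"
    using assms(2) by (rule double_B)
  have eq: "?x = fraction B ({#x#} + T) T"
    using xyy yy T by (simp add: B.fraction_eq_iff)
  have "?x \<in> carrier (localization B \<pp>)" if "\<pp> \<in> min_primes B" for \<pp>
  proof (cases "T \<in> \<pp>")
    case True
    then have "{#y, y#} \<notin> \<pp>"
      using min_prime_double[OF that assms(2)] T(2) by blast
    then show ?thesis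
      using xyy yy unfolding localization_def by auto
  next
    case False
    then show ?thesis
      using T unfolding eq localization_def by auto
  qed
  moreover have "?x \<in> carrier (quot_group B)"
    using xyy yy unfolding quot_group_def by auto
  ultimately have "?x \<in> quot_emb B ` carrier B"
    using wK unfolding weakly_Krull_def by blast
  then show False
    using xyy yy assms(3) singleton_B by (auto simp: B.fraction_in_quot_emb_iff)
qed

text \<open>The sequence \<open>{#x, y, y#}\<close> is an atom, as it has length 3 and the only element of \<open>B\<close> of length 1
  is the zero of \<open>G\<close>. But its square is divisible by the square of \<open>{#y, y#}\<close>.\<close>

lemma not_transfer_Krull:
  assumes "x \<in> carrier G" "y \<in> carrier G" "x \<noteq> \<one>" "y \<noteq> \<one>" "{#x, y, y#} \<in> carrier B"
  shows "\<not> transfer_Krull TYPE('c) B"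
proof
  assume "transfer_Krull TYPE('c) B"
  moreover have "{#x, y, y#} \<otimes>\<^bsub>B\<^esub> {#x, y, y#} = {#x, x#} \<otimes>\<^bsub>B\<^esub> ({#y, y#} \<otimes>\<^bsub>B\<^esub> {#y, y#})"
    by simp
  ultimately obtain S R where SR: "S \<in> carrier B - {{#}}" "R \<in> carrier B - {{#}}"
    "{#x, y, y#} = S + R"
    using transfer_Krull_square_factor[of B "{#y, y#}" "{#x, y, y#}" "{#x, x#}"]
      double_B[OF assms(1)] double_B[OF assms(2)] assms(5) unfolding Units_B by auto
  have long: "2 \<le> size U" if "U \<in> carrier B - {{#}}" "U \<subseteq># {#x, y, y#}" for U
  proof (rule ccontr)
    assume "\<not> 2 \<le> size U"
    moreover have "size U \<noteq> 0"
      using that(1) by simp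
    ultimately have "size U = 1"
      by linarith
    then obtain g where "U = {#g#}"
      using size_1_singleton_mset by blast
    then show False
      using that singleton_B[of g] assms(3,4) by auto
  qed
  have "2 \<le> size S" "2 \<le> size R"
    using long SR by (simp_all add: SR(3))
  then show False
    using arg_cong[OF SR(3), of size] by simp
qed

subsection \<open>Elementary 2-groups\<close>

lemma mem_B_elementary_iff:
  assumes "elementary_2_group G" "\<Gamma> = {\<lambda>g \<in> carrier G. g, \<lambda>g \<in> carrier G. inv g}"
  shows "S \<in> carrier B \<longleftrightarrow> (\<exists>gs. set gs \<subseteq> carrier G \<and> S = mset gs \<and> foldr (\<otimes>) gs \<one> = \<one>)"
proof -
  have "inv g = g" if "g \<in> carrier G" for g
    using assms(1) that inv_equality unfolding elementary_2_group_def by blast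
  then have weight: "\<gamma> g = g" if "\<gamma> \<in> \<Gamma>" "g \<in> carrier G" for \<gamma> g
    using that unfolding assms(2) by auto
  have prod: "weighted_prod ps = foldr (\<otimes>) (map snd ps) \<one>" if "set ps \<subseteq> \<Gamma> \<times> carrier G" for ps
    using that by (induction ps) (auto simp: weight)
  show ?thesis
    unfolding mem_B_iff
  proof
    assume "\<exists>ps. set ps \<subseteq> \<Gamma> \<times> carrier G \<and> S = mset (map snd ps) \<and> weighted_prod ps = \<one>"
    then obtain ps where "set ps \<subseteq> \<Gamma> \<times> carrier G" "S = mset (map snd ps)" "weighted_prod ps = \<one>"
      by blast
    then show "\<exists>gs. set gs \<subseteq> carrier G \<and> S = mset gs \<and> foldr (\<otimes>) gs \<one> = \<one>"
      using prod by (intro exI[of _ "map snd ps"]) auto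
  next
    assume "\<exists>gs. set gs \<subseteq> carrier G \<and> S = mset gs \<and> foldr (\<otimes>) gs \<one> = \<one>"
    then obtain gs where gs: "set gs \<subseteq> carrier G" "S = mset gs" "foldr (\<otimes>) gs \<one> = \<one>"
      by blast
    let ?ps = "map (Pair (\<lambda>g \<in> carrier G. g)) gs"
    have "set ?ps \<subseteq> \<Gamma> \<times> carrier G" "map snd ?ps = gs"
      using gs(1) id_weight by (auto simp: comp_def)
    then show "\<exists>ps. set ps \<subseteq> \<Gamma> \<times> carrier G \<and> S = mset (map snd ps) \<and> weighted_prod ps = \<one>"
      using gs prod by metis
  qed
qed

text \<open>All weights act as the identity, so membership in \<open>B\<close> means that the plain product is trivial.
  Hence a quotient in the free abelian monoid of two members of \<open>B\<close> is again in \<open>B\<close>.\<close>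

lemma torsion_valuations_B:
  assumes e: "elementary_2_group G" "\<Gamma> = {\<lambda>g \<in> carrier G. g, \<lambda>g \<in> carrier G. inv g}"
  shows "torsion_valuations B (carrier G) (\<lambda>g S. count S g)"
proof (intro torsion_valuations.intro torsion_valuations_axioms.intro)
  show "comm_monoid_cancel B"
    by (rule B.is_comm_monoid_cancel)
  show "finite {g \<in> carrier G. 0 < count S g}" for S
    by (rule finite_subset[of _ "set_mset S"]) auto
  show "\<exists>R \<in> carrier B. T = S \<otimes>\<^bsub>B\<^esub> R"
    if ST: "S \<in> carrier B" "T \<in> carrier B" "\<And>g. g \<in> carrier G \<Longrightarrow> count S g \<le> count T g" for S T
  proof -
    have "count S g \<le> count T g" for g
      using ST(3) set_mset_B[OF ST(1)] by (cases "g \<in># S") (auto simp: not_in_iff)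
    then have "S \<subseteq># T"
      by (simp add: subseteq_mset_def)
    then obtain R where T: "T = S + R"
      by (rule mset_subset_eq_exists_conv[THEN iffD1, THEN exE])
    obtain rs where rs: "R = mset rs"
      using ex_mset by metis
    obtain gs where gs: "set gs \<subseteq> carrier G" "S = mset gs" "foldr (\<otimes>) gs \<one> = \<one>"
      using ST(1) mem_B_elementary_iff[OF e] by blast
    obtain hs where hs: "set hs \<subseteq> carrier G" "T = mset hs" "foldr (\<otimes>) hs \<one> = \<one>"
      using ST(2) mem_B_elementary_iff[OF e] by blast
    have in_G: "set rs \<subseteq> carrier G"
      using set_mset_B[OF ST(2)] unfolding T rs by auto
    have split: "foldr (\<otimes>) gs z = foldr (\<otimes>) gs \<one> \<otimes> z" if "z \<in> carrier G" for z
      using gs(1) that by (induction gs) (auto simp: m_assoc)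
    have "mset hs = mset (gs @ rs)"
      using hs(2) gs(2) T rs by simp
    then have "foldr (\<otimes>) hs \<one> = foldr (\<otimes>) (gs @ rs) \<one>"
      using multlist_perm_cong[of hs "gs @ rs"] hs(1) by simp
    then have "foldr (\<otimes>) rs \<one> = \<one>"
      using hs(3) gs(3) split[of "foldr (\<otimes>) rs \<one>"] multlist_closed[OF in_G] by simp
    then have "R \<in> carrier B"
      using mem_B_elementary_iff[OF e] in_G rs by blast
    then show ?thesis
      using T by auto
  qed
  show "\<exists>S \<in> carrier B. 0 < count S g \<and> (\<forall>h \<in> carrier G - {g}. count S h = 0)"
    if "g \<in> carrier G" for g
    using double_B[OF that] by (intro bexI[of _ "{#g, g#}"]) auto
qed auto

lemma countable_B:
  assumes "finite (carrier G)"
  shows "countable (carrier B)"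
proof (rule countable_subset)
  show "carrier B \<subseteq> mset ` lists (carrier G)"
    unfolding carrier_B by auto
  show "countable (mset ` lists (carrier G))"
    using assms by (simp add: countable_finite)
qed

end

theorem theorem4p4:
  fixes G :: "('g, 'm) monoid_scheme" and \<Gamma> :: "('g \<Rightarrow> 'g) set"
  assumes "comm_group G" and "finite (carrier G)"
    and "\<Gamma> \<subseteq> auto G"
    and "{\<lambda>g \<in> carrier G. g, \<lambda>g \<in> carrier G. inv\<^bsub>G\<^esub> g} \<subseteq> \<Gamma>"
  shows "(root_closed (B_Gamma G \<Gamma>) \<longleftrightarrow> Krull (B_Gamma G \<Gamma>)) \<and>
    (Krull (B_Gamma G \<Gamma>) \<longleftrightarrow> transfer_Krull TYPE('b :: infinite) (B_Gamma G \<Gamma>)) \<and>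
    (transfer_Krull TYPE('b) (B_Gamma G \<Gamma>) \<longleftrightarrow> weakly_Krull (B_Gamma G \<Gamma>)) \<and>
    (weakly_Krull (B_Gamma G \<Gamma>) \<longleftrightarrow>
       elementary_2_group G \<and> \<Gamma> = {\<lambda>g \<in> carrier G. g, \<lambda>g \<in> carrier G. inv\<^bsub>G\<^esub> g})"
proof -
  interpret weighted_zero_sums G \<Gamma>
    using assms by (intro weighted_zero_sums.intro weighted_zero_sums_axioms.intro) auto
  let ?e = "elementary_2_group G \<and> \<Gamma> = {\<lambda>g \<in> carrier G. g, \<lambda>g \<in> carrier G. inv\<^bsub>G\<^esub> g}"
  have pos: "root_closed B" "Krull B" "weakly_Krull B" "transfer_Krull TYPE('b) B" if ?e
  proof -
    interpret torsion_valuations B "carrier G" "\<lambda>g S. count S g"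
      using that by (intro torsion_valuations_B) simp_all
    show "root_closed B" "Krull B" "weakly_Krull B" "transfer_Krull TYPE('b) B"
      using root_closed Krull weakly_Krull transfer_Krull[OF countable_B[OF assms(2)]] by auto
  qed
  have neg: "\<not> root_closed B" "\<not> weakly_Krull B" "\<not> transfer_Krull TYPE('b) B" if not_e: "\<not> ?e"
  proof -
    obtain x y T where "x \<in> carrier G" "y \<in> carrier G" "x \<noteq> \<one>\<^bsub>G\<^esub>" "y \<noteq> \<one>\<^bsub>G\<^esub>"
      "{#x, y, y#} \<in> carrier B" "T \<in> carrier B" "y \<notin># T" "{#x#} + T \<in> carrier B"
      using not_e by (rule obstruction)
    then show "\<not> root_closed B" "\<not> weakly_Krull B" "\<not> transfer_Krull TYPE('b) B"
      using not_root_closed not_weakly_Krull not_transfer_Krull by blast+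
  qed
  show ?thesis
  proof (cases ?e)
    case True
    then show ?thesis
      using pos by simp
  next
    case False
    moreover have "\<not> Krull B"
      using neg(2)[OF False] unfolding Krull_def by simp
    ultimately show ?thesis
      using neg by simp
  qed
qed

end
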